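(* Let $1\le p_1,p_2\le\infty$ and $p_3\ge1$ be such that $\frac1{p_1}+\frac1{p_2}<\frac1{p_3}$. Then $\tilde{\mathcal M}_{(p_1,p_2,p_3)}(\mathbb R)=\{0\}$.
   Context: The Fourier transform is $\hat f(\xi)=\int_{\mathbb R}f(x)e^{-2\pi i x\xi}dx$. $\mathcal P(\mathbb R)$ denotes the set of Schwartz functions on $\mathbb R$ whose Fourier transform is continuous with compact support. For $1\le p_1,p_2\le\infty$, $0<p_3\le\infty$, $\tilde{\mathcal M}_{(p_1,p_2,p_3)}(\mathbb R)$ is the space of measurable (locally integrable) $M:\mathbb R\to\mathbb C$ such that the bilinear operator $B_M(f,g)(x)=\int_{\mathbb R}\int_{\mathbb R}\hat f(\xi)\hat g(\eta)M(\xi-\eta)e^{2\pi i(\xi+\eta)x}d\xi\,d\eta$, $f,g\in\mathcal P(\mathbb R)$, satisfies $\|B_M(f,g)\|_{p_3}\le C\|f\|_{p_1}\|g\|_{p_2}$ for some $C$ and all $f,g\in\mathcal P(\mathbb R)$. Functions equal almost everywhere are identified. *)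

theory Defs
  imports "HOL-Analysis.Analysis"
begin

definition fourier :: "(real \<Rightarrow> complex) \<Rightarrow> real \<Rightarrow> complex" where
  "fourier f \<xi> = (LINT x|lborel. f x * cis (- 2 * pi * x * \<xi>))"

fun nth_deriv :: "nat \<Rightarrow> (real \<Rightarrow> complex) \<Rightarrow> real \<Rightarrow> complex" where
  "nth_deriv 0 f = f"
| "nth_deriv (Suc n) f = (\<lambda>x. vector_derivative (nth_deriv n f) (at x))"

definition schwartz :: "(real \<Rightarrow> complex) \<Rightarrow> bool" where
  "schwartz f \<longleftrightarrow>
     (\<forall>n x. (nth_deriv n f has_vector_derivative nth_deriv (Suc n) f x) (at x)) \<and>
     (\<forall>m n. bounded (range (\<lambda>x. of_real (x ^ m) * nth_deriv n f x)))"

definition P_class :: "(real \<Rightarrow> complex) set" where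
  "P_class = {f. schwartz f \<and> continuous_on UNIV (fourier f) \<and>
                 compact (closure {\<xi>. fourier f \<xi> \<noteq> 0})}"

definition Lp_norm :: "ennreal \<Rightarrow> (real \<Rightarrow> complex) \<Rightarrow> ennreal" where
  "Lp_norm p f =
     (if p = \<infinity> then Inf {C. AE x in lborel. ennreal (norm (f x)) \<le> C}
      else (let I = (\<integral>\<^sup>+ x. ennreal (norm (f x) powr enn2real p) \<partial>lborel)
            in if I = \<infinity> then \<infinity> else ennreal (enn2real I powr (1 / enn2real p))))"

definition bilin_op :: "(real \<Rightarrow> complex) \<Rightarrow> (real \<Rightarrow> complex) \<Rightarrow> (real \<Rightarrow> complex)
    \<Rightarrow> real \<Rightarrow> complex" where
  "bilin_op M f g x =
     (LINT z|(lborel \<Otimes>\<^sub>M lborel).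
        fourier f (fst z) * fourier g (snd z) * M (fst z - snd z) *
        cis (2 * pi * (fst z + snd z) * x))"

definition multiplier_space :: "ennreal \<Rightarrow> ennreal \<Rightarrow> ennreal \<Rightarrow> (real \<Rightarrow> complex) set" where
  "multiplier_space p1 p2 p3 =
     {M. M \<in> borel_measurable lborel \<and>
         (\<forall>K. compact K \<longrightarrow> set_integrable lborel K M) \<and>
         (\<exists>C::real. \<forall>f\<in>P_class. \<forall>g\<in>P_class.
             Lp_norm p3 (bilin_op M f g) \<le> ennreal C * Lp_norm p1 f * Lp_norm p2 g)}"

end

(* The operator commutes with simultaneous translations of f and g. Replacing f and g by sums
   of N widely separated translates multiplies their norms by at most a constant times N^(1/p1)
   and N^(1/p2), while the diagonal terms produce N separated copies of B_M(f,g), of norm about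
   N^(1/p3). If 1/p1 + 1/p2 < 1/p3 this forces B_M(f,g) = 0 for all f and g; letting the Fourier
   transforms increase to indicators of intervals gives M = 0 almost everywhere.

   The translates are placed at L * 2^j. Writing (xi,eta) = (eta + t, eta), the (j,k) term near
   L * 2^i oscillates in eta with frequency about L * (2 * 2^i - 2^j - 2^k), which is nonzero
   unless j = k = i. Integration by parts in eta alone, where the integrand is smooth, then makes
   the off-diagonal terms vanish as L tends to infinity, and Fatou's lemma isolates the diagonal. *)
theory Submission
  imports Defs "HOL-Probability.Characteristic_Functions" "HOL-Probability.Sinc_Integral" "HOL-Real_Asymp.Real_Asymp"
begin

section \<open>Smooth functions and cutoffs\<close>

text \<open>Since \<open>M\<close> is only locally integrable, no derivative may fall on it. The
  shear confines \<open>M\<close> to the variable t and leaves smooth factors in eta, which is why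
  the decay is extracted from the eta-frequency alone. Equally spaced positions would not serve:
  pairs with j + k = 2i and j \<noteq> i would be stationary in eta, out of reach of this
  integration by parts. Powers of two contain no such nontrivial midpoints.

  Two limits are taken in a fixed order, L at fixed N and then N, so the norm bounds for the sums
  must hold with one constant for all L \<ge> N. The lower bound is collected only on N translates
  of the unit interval, which gives vanishing of the operator on (0,1). This is enough: at one fixed
  point x the exponential merely multiplies the symbol by a factor of modulus 1, and f and g remain
  free. That freedom is the reason for the Fourier inversion theorem below, since the operator sees
  f and g only through their transforms.\<close>

primrec Ck :: "nat \<Rightarrow> (real \<Rightarrow> complex) \<Rightarrow> bool" where
  "Ck 0 f \<longleftrightarrow> continuous_on UNIV f"
| "Ck (Suc k) f \<longleftrightarrow> (\<exists>f'. (\<forall>x. (f has_vector_derivative f' x) (at x)) \<and> Ck k f')"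

text \<open>Kept apart from \<open>nth_deriv\<close>, which takes \<open>vector_derivative\<close>
  whether or not a derivative exists. With a derivative quantified existentially at each level,
  closure under sums, products and affine substitutions is an induction on the order.\<close>

definition smooth :: "(real \<Rightarrow> complex) \<Rightarrow> bool" where
  "smooth f \<longleftrightarrow> (\<forall>k. Ck k f)"

lemma Ck_SucD: "Ck (Suc k) f \<Longrightarrow> Ck k f"
proof (induction k arbitrary: f)
  case 0
  then show ?case
    by (fastforce intro: continuous_at_imp_continuous_on has_vector_derivative_continuous)
next
  case (Suc k)
  then show ?case by (metis Ck.simps(2))
qed

lemma smooth_continuous_on: "smooth f \<Longrightarrow> continuous_on S f"
  unfolding smooth_def by (metis Ck.simps(1) continuous_on_subset subset_UNIV)

lemma smooth_measurable [measurable_dest]: "smooth f \<Longrightarrow> f \<in> borel_measurable borel"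
  using smooth_continuous_on borel_measurable_continuous_onI by blast

text \<open>Each order k supplies its own derivative; uniqueness of derivatives merges them into one
  function, which is therefore smooth itself.\<close>

lemma smooth_derivE:
  assumes "smooth f"
  obtains f' where "\<And>x. (f has_vector_derivative f' x) (at x)" "smooth f'"
proof -
  obtain f' where f': "\<And>x. (f has_vector_derivative f' x) (at x)"
    using assms unfolding smooth_def by (metis Ck.simps(2))
  have "Ck k f'" for k
  proof -
    obtain g where g: "\<And>x. (f has_vector_derivative g x) (at x)" "Ck k g"
      using assms unfolding smooth_def by (metis Ck.simps(2))
    have "g = f'" using g(1) f' vector_derivative_unique_at by blast
    with g show ?thesis by simp
  qed
  with f' that show thesis unfolding smooth_def by blast
qed

section \<open>Closure properties of smooth functions\<close>

lemma Ck_const: "Ck k (\<lambda>_. c)"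
proof (induction k arbitrary: c)
  case (Suc k)
  then show ?case by (auto intro!: exI[of _ "\<lambda>_. 0"])
qed auto

lemma Ck_add: "Ck k f \<Longrightarrow> Ck k g \<Longrightarrow> Ck k (\<lambda>x. f x + g x)"
proof (induction k arbitrary: f g)
  case (Suc k)
  then obtain f' g' where "\<And>x. (f has_vector_derivative f' x) (at x)" "Ck k f'"
    "\<And>x. (g has_vector_derivative g' x) (at x)" "Ck k g'"
    by auto
  then show ?case
    by (auto intro!: exI[of _ "\<lambda>x. f' x + g' x"] Suc.IH has_vector_derivative_add)
qed (auto intro: continuous_intros)

lemma Ck_mult: "Ck k f \<Longrightarrow> Ck k g \<Longrightarrow> Ck k (\<lambda>x. f x * g x)"
proof (induction k arbitrary: f g)
  case (Suc k)
  then obtain f' g' where d: "\<And>x. (f has_vector_derivative f' x) (at x)" "Ck k f'"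
    "\<And>x. (g has_vector_derivative g' x) (at x)" "Ck k g'"
    by auto
  have "Ck k f" "Ck k g" using Suc.prems Ck_SucD by auto
  then have "Ck k (\<lambda>x. f x * g' x + f' x * g x)"
    using d by (intro Ck_add Suc.IH)
  then show ?case
    using d by (auto intro!: exI[of _ "\<lambda>x. f x * g' x + f' x * g x"] has_vector_derivative_mult)
qed (auto intro: continuous_intros)

lemma smooth_const: "smooth (\<lambda>_. c)"
  by (simp add: smooth_def Ck_const)

lemma smooth_add: "smooth f \<Longrightarrow> smooth g \<Longrightarrow> smooth (\<lambda>x. f x + g x)"
  by (simp add: smooth_def Ck_add)

lemma smooth_mult: "smooth f \<Longrightarrow> smooth g \<Longrightarrow> smooth (\<lambda>x. f x * g x)"
  by (simp add: smooth_def Ck_mult)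

lemma smooth_sum: "(\<And>i. i \<in> I \<Longrightarrow> smooth (f i)) \<Longrightarrow> smooth (\<lambda>x. \<Sum>i\<in>I. f i x)"
  by (induction I rule: infinite_finite_induct) (auto simp: smooth_const smooth_add)

lemma smooth_of_real: "smooth of_real"
proof -
  have "Ck k of_real" for k
  proof (cases k)
    case (Suc n)
    have "(of_real has_vector_derivative (1::complex)) (at x)" for x
      using has_vector_derivative_of_real[of "\<lambda>x. x" 1 "at x"] by simp
    then show ?thesis unfolding Suc by (auto intro!: exI[of _ "\<lambda>_. 1"] Ck_const)
  qed (auto intro: continuous_intros)
  then show ?thesis by (simp add: smooth_def)
qed

lemma has_vector_derivative_cis:
  "((\<lambda>x. cis (c * x)) has_vector_derivative (\<i> * of_real c) * cis (c * x)) (at x within S)"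
proof -
  have "((\<lambda>z. exp (\<i> * of_real c * z)) has_field_derivative (\<i> * of_real c) * exp (\<i> * of_real c * of_real x)) (at (of_real x))"
    by (auto intro!: derivative_eq_intros)
  from has_vector_derivative_real_field[OF this] show ?thesis
    by (simp add: cis_conv_exp mult.assoc)
qed

lemma smooth_cis: "smooth (\<lambda>x. cis (c * x))"
proof -
  have "Ck k (\<lambda>x. cis (c * x))" for k
  proof (induction k)
    case (Suc k)
    show ?case
      by (auto intro!: exI[of _ "\<lambda>x. (\<i> * of_real c) * cis (c * x)"] Suc Ck_const Ck_mult has_vector_derivative_cis)
  qed (auto simp: cis_conv_exp intro!: continuous_intros)
  then show ?thesis by (simp add: smooth_def)
qed

lemma smooth_affine:
  assumes "smooth f" shows "smooth (\<lambda>x. f (a + b * x))"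
proof -
  have "Ck k f \<Longrightarrow> Ck k (\<lambda>x. f (a + b * x))" for k
  proof (induction k arbitrary: f)
    case 0
    then show ?case by (auto intro!: continuous_intros elim!: continuous_on_compose2)
  next
    case (Suc k)
    then obtain f' where f': "\<And>x. (f has_vector_derivative f' x) (at x)" "Ck k f'" by auto
    have "((\<lambda>x. f (a + b * x)) has_vector_derivative (of_real b * f' (a + b * x))) (at x)" for x
    proof -
      have "((\<lambda>x. a + b * x) has_vector_derivative b) (at x)"
        by (auto intro!: derivative_eq_intros simp: has_real_derivative_iff_has_vector_derivative[symmetric])
      from vector_diff_chain_at[OF this f'(1)] show ?thesis
        by (simp add: o_def scaleR_conv_of_real)
    qed
    then show ?case
      by (auto intro!: exI[of _ "\<lambda>x. of_real b * f' (a + b * x)"] Ck_mult Ck_const Suc.IH f')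
  qed
  with assms show ?thesis by (simp add: smooth_def)
qed

text \<open>The polynomial factor in 1 / t makes the family closed under differentiation.\<close>
definition exp_cutoff :: "real poly \<Rightarrow> real \<Rightarrow> real" where
  "exp_cutoff q t = (if t > 0 then poly q (1 / t) * exp (- (1 / t)) else 0)"

lemma tendsto_poly_times_exp_minus: "((\<lambda>x. poly q x * exp (- x)) \<longlongrightarrow> (0::real)) at_top"
proof -
  have "((\<lambda>x. \<Sum>i\<le>degree q. coeff q i * (x ^ i / exp x)) \<longlongrightarrow> (\<Sum>i\<le>degree q. coeff q i * 0)) at_top"
    by (intro tendsto_intros tendsto_power_div_exp_0)
  then show ?thesis
    by (simp add: poly_altdef sum_divide_distrib exp_minus divide_inverse[symmetric])
qed

lemma exp_cutoff_tendsto_0: "(exp_cutoff q \<longlongrightarrow> 0) (at 0)"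
proof (rule filterlim_split_at)
  show "(exp_cutoff q \<longlongrightarrow> 0) (at_left 0)"
    by (rule tendsto_eventually) (auto simp: exp_cutoff_def eventually_at_filter)
  have "((\<lambda>t. poly q (inverse t) * exp (- inverse t)) \<longlongrightarrow> 0) (at_right 0)"
    by (rule filterlim_compose[OF tendsto_poly_times_exp_minus filterlim_inverse_at_top_right])
  then show "(exp_cutoff q \<longlongrightarrow> 0) (at_right 0)"
    by (rule Lim_transform_eventually) (auto simp: exp_cutoff_def eventually_at_filter inverse_eq_divide)
qed

text \<open>With s = 1/t the product rule gives s^2 * (q(s) - q'(s)) * exp(-s), which is where the
  new polynomial comes from.\<close>

lemma exp_cutoff_deriv:
  "(exp_cutoff q has_real_derivative exp_cutoff ([:0, 0, 1:] * (q - pderiv q)) t) (at t)"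
proof (cases t "0::real" rule: linorder_cases)
  case less
  have "((\<lambda>_. 0) has_real_derivative 0) (at t)" by simp
  then have "(exp_cutoff q has_real_derivative 0) (at t)"
    by (rule has_field_derivative_transform_within_open[of _ _ _ "{..<0}"]) (use less in \<open>auto simp: exp_cutoff_def\<close>)
  with less show ?thesis by (simp add: exp_cutoff_def)
next
  case equal
  \<comment> \<open>Dividing by h multiplies q by its variable, so the difference quotient at 0 is
    the cutoff of \<open>pCons 0 q\<close> and tends to 0.\<close>
  have "((\<lambda>h. exp_cutoff q h / h) \<longlongrightarrow> 0) (at 0)"
    by (rule Lim_transform_eventually[OF exp_cutoff_tendsto_0[of "pCons 0 q"]])
       (auto simp: exp_cutoff_def eventually_at_filter)
  then show ?thesis
    by (simp add: equal DERIV_def exp_cutoff_def)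
next
  case greater
  have "((\<lambda>t. poly q (1 / t) * exp (- (1 / t))) has_real_derivative
      exp_cutoff ([:0, 0, 1:] * (q - pderiv q)) t) (at t)"
    using greater
    by (auto intro!: derivative_eq_intros DERIV_chain2[OF poly_DERIV] simp: exp_cutoff_def field_simps power2_eq_square)
  then show ?thesis
    by (rule has_field_derivative_transform_within_open[of _ _ _ "{0<..}"]) (use greater in \<open>auto simp: exp_cutoff_def\<close>)
qed

lemma smooth_exp_cutoff: "smooth (\<lambda>t. of_real (exp_cutoff q t))"
proof -
  have "Ck k (\<lambda>t. of_real (exp_cutoff q t))" for k
  proof (induction k arbitrary: q)
    case 0
    have "isCont (exp_cutoff q) t" for t
      using exp_cutoff_deriv DERIV_isCont by blast
    then show ?case
      by (auto intro!: continuous_intros continuous_at_imp_continuous_on)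
  next
    case (Suc k)
    have "((\<lambda>t. complex_of_real (exp_cutoff q t)) has_vector_derivative
        of_real (exp_cutoff ([:0, 0, 1:] * (q - pderiv q)) t)) (at t)" for t
      by (intro has_vector_derivative_of_real exp_cutoff_deriv)
    with Suc show ?case
      unfolding Ck.simps by (intro exI[of _ "\<lambda>t. of_real (exp_cutoff ([:0, 0, 1:] * (q - pderiv q)) t)"]) blast
  qed
  then show ?thesis by (simp add: smooth_def)
qed

text \<open>Inside (a,b) and for n > 0 the factors are exp(-1/(n * d)), with d the distance to an
  endpoint. They tend to 1 as n grows while the support stays fixed: smooth approximations of an
  indicator, bounded by 1.\<close>

definition bump :: "real \<Rightarrow> real \<Rightarrow> nat \<Rightarrow> real \<Rightarrow> complex" where
  "bump a b n x = of_real (exp_cutoff 1 (real n * (x - a)) * exp_cutoff 1 (real n * (b - x)))"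

lemma smooth_bump: "smooth (bump a b n)"
proof -
  have "smooth (\<lambda>x. of_real (exp_cutoff 1 (- real n * a + real n * x)) * of_real (exp_cutoff 1 (real n * b + (- real n) * x)))"
    by (intro smooth_mult smooth_affine[where f="\<lambda>x. of_real (exp_cutoff 1 x)"] smooth_exp_cutoff)
  then show ?thesis
    by (simp add: bump_def[abs_def] algebra_simps)
qed

lemma norm_bump_le: "norm (bump a b n x) \<le> indicator {a<..<b} x"
proof -
  have "0 \<le> exp_cutoff 1 t" "exp_cutoff 1 t \<le> 1" for t
    by (auto simp: exp_cutoff_def)
  moreover have "exp_cutoff 1 (real n * (x - a)) * exp_cutoff 1 (real n * (b - x)) = 0" if "x \<notin> {a<..<b}"
    using that by (auto simp: exp_cutoff_def zero_less_mult_iff)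
  ultimately show ?thesis
    by (auto simp: bump_def indicator_def norm_mult intro!: mult_le_one)
qed

lemma bump_tendsto: "(\<lambda>n. bump a b n x) \<longlonglongrightarrow> of_bool (x \<in> {a<..<b})"
proof (cases "x \<in> {a<..<b}")
  case True
  have "(\<lambda>n. exp_cutoff 1 (real n * c)) \<longlonglongrightarrow> 1" if "c > 0" for c
  proof -
    have "(\<lambda>n. exp (- (1 / (real n * c)))) \<longlonglongrightarrow> 1" using that by real_asymp
    then show ?thesis
      by (rule Lim_transform_eventually)
         (use that in \<open>auto simp: exp_cutoff_def intro!: eventually_mono[OF eventually_gt_at_top[of 0]]\<close>)
  qed
  then have "(\<lambda>n. bump a b n x) \<longlonglongrightarrow> of_real (1 * 1)"
    unfolding bump_def using True by (intro tendsto_intros) auto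
  with True show ?thesis by simp
next
  case False
  then have "bump a b n x = 0" for n
    using norm_bump_le[of a b n x] by (simp split: split_indicator_asm)
  moreover have "of_bool (x \<in> {a<..<b}) = (0::complex)" using False by (simp only: of_bool_def if_False)
  ultimately show ?thesis by (simp only: tendsto_const)
qed

section \<open>Inverse Fourier transforms of test functions\<close>

text \<open>The radius is explicit so that two functions can share it, which puts the difference of
  their frequencies in [-2A, 2A]. Including |x| = A removes the boundary terms at -A and A when
  integrating by parts.\<close>

definition test :: "real \<Rightarrow> (real \<Rightarrow> complex) \<Rightarrow> bool" where
  "test A \<phi> \<longleftrightarrow> smooth \<phi> \<and> 0 \<le> A \<and> (\<forall>x. A \<le> \<bar>x\<bar> \<longrightarrow> \<phi> x = 0)"

definition inv_fourier :: "(real \<Rightarrow> complex) \<Rightarrow> real \<Rightarrow> complex" where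
  "inv_fourier \<phi> x = (LINT \<xi>|lborel. \<phi> \<xi> * cis (2 * pi * x * \<xi>))"

lemma test_smooth: "test A \<phi> \<Longrightarrow> smooth \<phi>"
  by (simp add: test_def)

lemma test_measurable [measurable_dest]: "test A \<phi> \<Longrightarrow> \<phi> \<in> borel_measurable borel"
  by (simp add: test_def smooth_measurable)

lemma test_mult_smooth: "test A \<phi> \<Longrightarrow> smooth g \<Longrightarrow> test A (\<lambda>x. \<phi> x * g x)"
  by (simp add: test_def smooth_mult)

lemma test_bounded:
  assumes "test A \<phi>"
  obtains B where "B \<ge> 0" "\<And>x. norm (\<phi> x) \<le> B * indicator {-A..A} x" "\<And>x. norm (\<phi> x) \<le> B"
proof -
  have "bounded (\<phi> ` {-A..A})"
    using assms by (intro compact_imp_bounded compact_continuous_image smooth_continuous_on test_smooth) auto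
  then obtain B where B: "\<And>x. x \<in> {-A..A} \<Longrightarrow> norm (\<phi> x) \<le> B"
    unfolding bounded_iff by (metis imageI)
  have z: "x \<notin> {-A..A} \<Longrightarrow> \<phi> x = 0" for x using assms by (auto simp: test_def)
  show thesis
  proof (rule that[of "max 0 B"])
    show "norm (\<phi> x) \<le> max 0 B * indicator {-A..A} x" for x
      using B[of x] z[of x] by (auto simp: indicator_def)
    show "norm (\<phi> x) \<le> max 0 B" for x
      using B[of x] z[of x] by (cases "x \<in> {-A..A}") auto
  qed auto
qed

lemma test_indicator: "test A \<phi> \<Longrightarrow> indicator {-A..A} x *\<^sub>R (\<phi> x * z) = \<phi> x * z"
  by (auto simp: test_def indicator_def)

lemma test_integrable_mult:
  assumes "test A \<phi>" "continuous_on UNIV g"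
  shows "integrable lborel (\<lambda>x. \<phi> x * g x)"
proof -
  have "integrable lborel (\<lambda>x. indicator {-A..A} x *\<^sub>R (\<phi> x * g x))"
    using assms by (intro borel_integrable_compact continuous_on_mult)
      (auto intro: continuous_on_subset smooth_continuous_on test_smooth)
  then show ?thesis
    using assms by (simp add: test_indicator)
qed

lemma test_integrable: "test A \<phi> \<Longrightarrow> integrable lborel \<phi>"
  using test_integrable_mult[of A \<phi> "\<lambda>_. 1"] by simp

lemma test_integrable_cis: "test A \<phi> \<Longrightarrow> integrable lborel (\<lambda>x. \<phi> x * cis (c * x))"
  by (intro test_integrable_mult smooth_continuous_on smooth_cis)

lemma test_derivE:
  assumes "test A \<phi>"
  obtains \<phi>' where "\<And>x. (\<phi> has_vector_derivative \<phi>' x) (at x)" "test A \<phi>'"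
proof -
  obtain \<phi>' where d: "\<And>x. (\<phi> has_vector_derivative \<phi>' x) (at x)" "smooth \<phi>'"
    using assms test_smooth smooth_derivE by metis
  have "\<phi>' x = 0" if x: "A \<le> \<bar>x\<bar>" for x
  proof -
    \<comment> \<open>At |x| = A vanishing is known on one side only, so the derivative is computed
      within the ray from x away from 0. As x is not isolated in that ray, the derivative within it
      is unique.\<close>
    define S where "S = (if x \<ge> 0 then {x..} else {..x})"
    have S: "\<phi> y = 0" if "y \<in> S" for y
      using that x assms by (auto simp: S_def test_def split: if_splits)
    have "x \<in> S" by (simp add: S_def)
    have "((\<lambda>_. 0) has_vector_derivative \<phi>' x) (at x within S)"
      by (rule has_vector_derivative_transform[OF \<open>x \<in> S\<close> _ has_vector_derivative_at_within[OF d(1)]]) (simp add: S)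
    moreover have "((\<lambda>_. 0::complex) has_vector_derivative 0) (at x within S)" by simp
    moreover have "at_right x \<le> at x within {x..}" "at_left x \<le> at x within {..x}"
      by (auto intro!: at_le)
    then have "at x within S \<noteq> bot"
      using trivial_limit_at_right_real[of x] trivial_limit_at_left_real[of x]
      unfolding S_def by (metis le_bot)
    ultimately show ?thesis using vector_derivative_unique_within by blast
  qed
  with assms d that show thesis by (auto simp: test_def)
qed

lemma integral_test_deriv:
  assumes "test A \<phi>" "test A \<phi>'" "\<And>x. (\<phi> has_vector_derivative \<phi>' x) (at x)"
  shows "(LINT x|lborel. \<phi>' x) = 0"
proof -
  have "(LINT x|lborel. indicator {-A..A} x *\<^sub>R \<phi>' x) = \<phi> A - \<phi> (-A)"
    using assms by (intro integral_FTC_Icc smooth_continuous_on test_smooth)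
      (auto simp: test_def intro: has_vector_derivative_at_within)
  then show ?thesis
    using assms test_indicator[of A \<phi>' _ 1] by (simp add: test_def)
qed

lemma norm_inv_fourier_le: "norm (inv_fourier \<phi> x) \<le> (LINT \<xi>|lborel. norm (\<phi> \<xi>))"
  unfolding inv_fourier_def
  using integral_norm_bound[of lborel "\<lambda>\<xi>. \<phi> \<xi> * cis (2 * pi * x * \<xi>)"] by (simp add: norm_mult)

text \<open>The product of \<phi> with the character has compact support, so its derivative
  integrates to 0, and the product rule splits this into the two transforms. Each use trades a
  factor x for a derivative of \<phi>.\<close>

lemma inv_fourier_by_parts:
  assumes "test A \<phi>" "test A \<phi>'" "\<And>x. (\<phi> has_vector_derivative \<phi>' x) (at x)"
  shows "2 * pi * x * inv_fourier \<phi> x = \<i> * inv_fourier \<phi>' x"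
proof -
  let ?c = "2 * pi * x"
  have d: "((\<lambda>\<xi>. \<phi> \<xi> * cis (?c * \<xi>)) has_vector_derivative
     (\<phi> \<xi> * ((\<i> * of_real ?c) * cis (?c * \<xi>)) + \<phi>' \<xi> * cis (?c * \<xi>))) (at \<xi>)" for \<xi>
    by (intro has_vector_derivative_mult assms has_vector_derivative_cis)
  have t: "test A (\<lambda>\<xi>. \<phi> \<xi> * ((\<i> * of_real ?c) * cis (?c * \<xi>)) + \<phi>' \<xi> * cis (?c * \<xi>))"
    using assms by (auto simp: test_def intro!: smooth_add smooth_mult smooth_const smooth_cis)
  have "0 = (LINT \<xi>|lborel. \<phi> \<xi> * ((\<i> * of_real ?c) * cis (?c * \<xi>)) + \<phi>' \<xi> * cis (?c * \<xi>))"
    by (rule integral_test_deriv[OF _ t d, symmetric]) (intro test_mult_smooth assms smooth_cis)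
  also have "\<dots> = (LINT \<xi>|lborel. (\<i> * of_real ?c) * (\<phi> \<xi> * cis (?c * \<xi>)) + \<phi>' \<xi> * cis (?c * \<xi>))"
    by (simp add: mult_ac)
  also have "\<dots> = (\<i> * of_real ?c) * inv_fourier \<phi> x + inv_fourier \<phi>' x"
    unfolding inv_fourier_def
    by (subst Bochner_Integration.integral_add) (auto intro!: integrable_mult_right test_integrable_cis assms)
  finally have "\<i> * 0 = \<i> * ((\<i> * of_real ?c) * inv_fourier \<phi> x + inv_fourier \<phi>' x)" by simp
  then show ?thesis by (simp add: algebra_simps)
qed

text \<open>Gives the Henstock-Kurzweil form over a compact interval, to which
  \<open>leibniz_rule_vector_derivative\<close> applies.\<close>

lemma inv_fourier_eq_integral:
  assumes "test A \<phi>"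
  shows "inv_fourier \<phi> x = integral (cbox (-A) A) (\<lambda>\<xi>. \<phi> \<xi> * cis (2 * pi * x * \<xi>))"
proof -
  have "set_integrable lborel {-A..A} (\<lambda>\<xi>. \<phi> \<xi> * cis (2 * pi * x * \<xi>))"
    unfolding set_integrable_def using assms by (simp only: test_indicator test_integrable_cis)
  from set_borel_integral_eq_integral(2)[OF this] assms show ?thesis
    by (simp add: inv_fourier_def set_lebesgue_integral_def test_indicator)
qed

lemma inv_fourier_deriv:
  assumes "test A \<phi>"
  shows "(inv_fourier \<phi> has_vector_derivative inv_fourier (\<lambda>\<xi>. \<phi> \<xi> * (2 * pi * \<i> * of_real \<xi>)) x) (at x)"
proof -
  have t: "test A (\<lambda>\<xi>. \<phi> \<xi> * (2 * pi * \<i> * of_real \<xi>))"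
    by (intro test_mult_smooth assms smooth_mult smooth_const smooth_of_real)
  have c: "continuous_on S (\<lambda>p. \<phi> (snd p))" for S :: "(real \<times> real) set"
    using smooth_continuous_on[OF test_smooth[OF assms], of UNIV] by (auto intro!: continuous_intros elim!: continuous_on_compose2)
  have "((\<lambda>x. integral (cbox (-A) A) (\<lambda>\<xi>. \<phi> \<xi> * cis (2 * pi * x * \<xi>))) has_vector_derivative
      integral (cbox (-A) A) (\<lambda>\<xi>. \<phi> \<xi> * (2 * pi * \<i> * of_real \<xi>) * cis (2 * pi * x * \<xi>))) (at x within UNIV)"
  proof (rule leibniz_rule_vector_derivative)
    fix y \<xi> :: real
    show "((\<lambda>x. \<phi> \<xi> * cis (2 * pi * x * \<xi>)) has_vector_derivative
        \<phi> \<xi> * (2 * pi * \<i> * of_real \<xi>) * cis (2 * pi * y * \<xi>)) (at y within UNIV)"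
      using has_vector_derivative_mult_right[OF has_vector_derivative_cis[of "2 * pi * \<xi>" y UNIV], of "\<phi> \<xi>"]
      by (simp add: mult_ac)
    show "(\<lambda>\<xi>. \<phi> \<xi> * cis (2 * pi * y * \<xi>)) integrable_on cbox (-A) A"
      by (intro integrable_continuous continuous_intros smooth_continuous_on test_smooth[OF assms] smooth_cis)
    show "continuous_on (UNIV \<times> cbox (-A) A) (\<lambda>(x, t). \<phi> t * (2 * pi * \<i> * of_real t) * cis (2 * pi * x * t))"
      unfolding split_beta cis_conv_exp by (intro continuous_intros c)
  qed auto
  then show ?thesis
    by (simp only: inv_fourier_eq_integral[OF assms, abs_def] inv_fourier_eq_integral[OF t])
qed

section \<open>Rapid decay and membership in the Schwartz class\<close>

lemma bounded_scaling_complex: "bounded S \<Longrightarrow> bounded ((\<lambda>x. c * x) ` S)" for c :: complex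
  by (rule bounded_linear_image[OF _ bounded_linear_mult_right])

lemma inv_fourier_decay:
  assumes "test A \<phi>"
  shows "bounded (range (\<lambda>x. of_real (x ^ m) * inv_fourier \<phi> x))"
  using assms
proof (induction m arbitrary: \<phi>)
  case 0
  then show ?case
    using norm_inv_fourier_le by (auto simp: bounded_iff)
next
  case (Suc m)
  obtain \<phi>' where d: "\<And>x. (\<phi> has_vector_derivative \<phi>' x) (at x)" "test A \<phi>'"
    using test_derivE[OF Suc.prems] by metis
  have eq: "of_real (x ^ Suc m) * inv_fourier \<phi> x = \<i> / (2 * pi) * (of_real (x ^ m) * inv_fourier \<phi>' x)" for x
    using inv_fourier_by_parts[OF Suc.prems d(2,1), of x] by (simp add: field_simps)
  show ?case
    unfolding eq using bounded_scaling_complex[OF Suc.IH[OF d(2)]] by (metis (no_types, lifting) image_image image_cong)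
qed

lemma nth_deriv_inv_fourier:
  assumes "test A \<phi>"
  shows "nth_deriv n (inv_fourier \<phi>) = inv_fourier (\<lambda>\<xi>. \<phi> \<xi> * (2 * pi * \<i> * of_real \<xi>) ^ n)"
    and "test A (\<lambda>\<xi>. \<phi> \<xi> * (2 * pi * \<i> * of_real \<xi>) ^ n)"
proof -
  have t: "test A (\<lambda>\<xi>. \<phi> \<xi> * (2 * pi * \<i> * of_real \<xi>) ^ n)" for n
  proof (induction n)
    case (Suc n)
    have "test A (\<lambda>\<xi>. \<phi> \<xi> * (2 * pi * \<i> * of_real \<xi>) ^ n * (2 * pi * \<i> * of_real \<xi>))"
      by (intro test_mult_smooth[OF Suc] smooth_mult smooth_const smooth_of_real)
    then show ?case by (simp add: mult_ac)
  qed (simp add: assms)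
  show "nth_deriv n (inv_fourier \<phi>) = inv_fourier (\<lambda>\<xi>. \<phi> \<xi> * (2 * pi * \<i> * of_real \<xi>) ^ n)"
  proof (induction n)
    case (Suc n)
    show ?case
      using vector_derivative_at[OF inv_fourier_deriv[OF t[of n]]] by (simp add: Suc fun_eq_iff mult_ac)
  qed simp
  show "test A (\<lambda>\<xi>. \<phi> \<xi> * (2 * pi * \<i> * of_real \<xi>) ^ n)" by (rule t)
qed

lemma schwartz_inv_fourier:
  assumes "test A \<phi>" shows "schwartz (inv_fourier \<phi>)"
  unfolding schwartz_def
proof (intro conjI allI)
  fix n m :: nat and x :: real
  note n = nth_deriv_inv_fourier[OF assms]
  show "(nth_deriv n (inv_fourier \<phi>) has_vector_derivative nth_deriv (Suc n) (inv_fourier \<phi>) x) (at x)"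
    unfolding n using inv_fourier_deriv[OF n(2)[of n], of x] by (simp add: mult_ac)
  show "bounded (range (\<lambda>x. of_real (x ^ m) * nth_deriv n (inv_fourier \<phi>) x))"
    unfolding n by (rule inv_fourier_decay[OF n(2)])
qed

lemma inv_fourier_continuous: "test A \<phi> \<Longrightarrow> continuous_on S (inv_fourier \<phi>)"
  using inv_fourier_deriv has_vector_derivative_continuous
  by (metis continuous_at_imp_continuous_on)

lemma inv_fourier_measurable [measurable_dest]: "test A \<phi> \<Longrightarrow> inv_fourier \<phi> \<in> borel_measurable borel"
  by (intro borel_measurable_continuous_onI inv_fourier_continuous)

text \<open>First-order decay, with one constant for both bounds, is all that
  \<open>separated_sum_le\<close> asks for.\<close>

lemma inv_fourier_bound:
  assumes "test A \<phi>"
  obtains D where "D \<ge> 0" "\<And>x. norm (inv_fourier \<phi> x) \<le> D" "\<And>x. \<bar>x\<bar> * norm (inv_fourier \<phi> x) \<le> D"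
proof -
  obtain a b where "\<And>x. norm (inv_fourier \<phi> x) \<le> a" "\<And>x. \<bar>x\<bar> * norm (inv_fourier \<phi> x) \<le> b"
    using inv_fourier_decay[OF assms, of 0] inv_fourier_decay[OF assms, of 1]
    by (auto simp: bounded_iff norm_mult)
  then show thesis
    by (intro that[of "max a b"]) (auto simp: le_max_iff_disj intro: order.trans[OF norm_ge_zero])
qed

lemma inv_fourier_integrable:
  assumes "test A \<phi>" shows "integrable lborel (inv_fourier \<phi>)"
proof -
  obtain a b where ab: "\<And>x. norm (inv_fourier \<phi> x) \<le> a" "\<And>x. x\<^sup>2 * norm (inv_fourier \<phi> x) \<le> b"
    using inv_fourier_decay[OF assms, of 0] inv_fourier_decay[OF assms, of 2]
    by (auto simp: bounded_iff norm_mult norm_power)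
  have "integrable lborel (\<lambda>x::real. inverse (1 + x\<^sup>2))"
    using integrable_inverse_1_plus_square by (simp add: set_integrable_def einterval_eq_UNIV)
  then have "integrable lborel (\<lambda>x::real. (a + b) * inverse (1 + x\<^sup>2))"
    by (rule integrable_mult_right)
  then show ?thesis
  proof (rule Bochner_Integration.integrable_bound)
    have "norm (inv_fourier \<phi> x) \<le> (a + b) * inverse (1 + x\<^sup>2)" for x
    proof -
      have "norm (inv_fourier \<phi> x) * (1 + x\<^sup>2) \<le> a + b"
        using ab[of x] by (simp add: algebra_simps)
      then show ?thesis by (simp add: field_simps add_pos_nonneg)
    qed
    then show "AE x in lborel. norm (inv_fourier \<phi> x) \<le> norm ((a + b) * inverse (1 + x\<^sup>2))"
      by (auto intro: order.trans[OF _ abs_ge_self])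
  qed (use assms in measurable)
qed

section \<open>Fourier inversion\<close>

lemma integrable_pair_mult:
  fixes f g :: "real \<Rightarrow> complex"
  assumes "integrable lborel f" "integrable lborel g"
  shows "integrable (lborel \<Otimes>\<^sub>M lborel) (\<lambda>z. f (fst z) * g (snd z))"
proof -
  have [measurable]: "f \<in> borel_measurable lborel" "g \<in> borel_measurable lborel"
    using assms by auto
  show ?thesis
    by (rule lborel_pair.Fubini_integrable) (use assms in \<open>auto simp: norm_mult\<close>)
qed

text \<open>The characteristic function of the standard normal law, that is, the self-duality of the
  Gaussian behind the inversion theorem.\<close>

lemma integral_cis_std_normal_density:
  "(LINT x|lborel. cis (c * x) * of_real (std_normal_density x)) = of_real (exp (- c\<^sup>2 / 2))"
proof -
  have "(LINT x|lborel. cis (c * x) * of_real (std_normal_density x)) = char std_normal_distribution c"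
    unfolding char_def by (subst integral_density) (auto simp: cis_conv_exp scaleR_conv_of_real mult_ac)
  then show ?thesis by (simp add: char_std_normal_distribution)
qed

text \<open>Lets the transforms of f and g be prescribed as arbitrary test functions. Without a
  weight the double integrand, \<phi>(\<xi>) times a character, has constant modulus in x and is in
  general not integrable over the plane, so Fubini needs the Gaussian factor.\<close>

lemma fourier_inv_fourier:
  assumes \<phi>: "test A \<phi>"
  shows "fourier (inv_fourier \<phi>) = \<phi>"
proof
  fix \<eta> :: real
  note [measurable] = test_measurable[OF \<phi>] inv_fourier_measurable[OF \<phi>]
  let ?\<gamma> = std_normal_density
  obtain B where B: "B \<ge> 0" "\<And>x. norm (\<phi> x) \<le> B" using test_bounded[OF \<phi>] by metis
  have \<gamma>0: "?\<gamma> 0 = 1 / sqrt (2 * pi)" by (simp add: std_normal_density_def)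
  have \<gamma>_le: "?\<gamma> x \<le> ?\<gamma> 0" "0 \<le> ?\<gamma> x" for x
    by (auto simp: std_normal_density_def intro!: divide_right_mono)
  have \<gamma>_int: "integrable lborel ?\<gamma>" by (rule integrable_normal_density) simp
  \<comment> \<open>Gaussian regularisation: the limit of J is computed directly, and again after Fubini.\<close>
  define J where "J n = (LINT x|lborel. inv_fourier \<phi> x * cis (- 2 * pi * x * \<eta>) * of_real (?\<gamma> (x / Suc n)))" for n :: nat
  have "J \<longlonglongrightarrow> (LINT x|lborel. inv_fourier \<phi> x * cis (- 2 * pi * x * \<eta>) * of_real (?\<gamma> 0))"
    unfolding J_def
  proof (rule integral_dominated_convergence[where w="\<lambda>x. norm (inv_fourier \<phi> x) * ?\<gamma> 0"])
    show "integrable lborel (\<lambda>x. norm (inv_fourier \<phi> x) * ?\<gamma> 0)"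
      using inv_fourier_integrable[OF \<phi>] by simp
    show "AE x in lborel. (\<lambda>n. inv_fourier \<phi> x * cis (- 2 * pi * x * \<eta>) * of_real (?\<gamma> (x / Suc n))) \<longlonglongrightarrow>
        inv_fourier \<phi> x * cis (- 2 * pi * x * \<eta>) * of_real (?\<gamma> 0)"
    proof (intro AE_I2 tendsto_intros)
      fix x :: real
      have "(\<lambda>n. x / Suc n) \<longlonglongrightarrow> 0" by real_asymp
      moreover have "isCont ?\<gamma> 0"
        unfolding std_normal_density_def by (intro continuous_intros) auto
      ultimately show "(\<lambda>n. ?\<gamma> (x / Suc n)) \<longlonglongrightarrow> ?\<gamma> 0"
        using isCont_tendsto_compose by blast
    qed
    show "AE x in lborel. norm (inv_fourier \<phi> x * cis (- 2 * pi * x * \<eta>) * of_real (?\<gamma> (x / Suc n))) \<le> norm (inv_fourier \<phi> x) * ?\<gamma> 0" for n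
      using \<gamma>_le by (auto simp: norm_mult intro!: mult_left_mono)
  qed (unfold cis_conv_exp, measurable)
  then have lim1: "J \<longlonglongrightarrow> fourier (inv_fourier \<phi>) \<eta> * of_real (?\<gamma> 0)"
    by (simp add: fourier_def)
  have J: "J n = 1 / sqrt (2 * pi) * (LINT s|lborel. \<phi> (\<eta> + 1 / (2 * pi * Suc n) * s) * of_real (?\<gamma> s))" for n
  proof -
    define N where "N = real (Suc n)"
    have N: "N > 0" by (simp add: N_def)
    have \<gamma>N_int: "integrable lborel (\<lambda>x. ?\<gamma> (x / N))"
      using lborel_integrable_real_affine[OF \<gamma>_int, of "1 / N" 0] N by simp
    have "integrable (lborel \<Otimes>\<^sub>M lborel) (\<lambda>z. complex_of_real (?\<gamma> (fst z / N)) * \<phi> (snd z))"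
      using \<gamma>N_int test_integrable[OF \<phi>] by (intro integrable_pair_mult) auto
    then have int: "integrable (lborel \<Otimes>\<^sub>M lborel) (\<lambda>(x, \<xi>). \<phi> \<xi> * (cis (2 * pi * (\<xi> - \<eta>) * x) * of_real (?\<gamma> (x / N))))"
      by (rule Bochner_Integration.integrable_bound) (auto simp: norm_mult cis_conv_exp)
    have inner: "(LINT x|lborel. cis (2 * pi * (\<xi> - \<eta>) * x) * of_real (?\<gamma> (x / N))) = of_real (N * exp (- (2 * pi * N * (\<xi> - \<eta>))\<^sup>2 / 2))" for \<xi>
    proof -
      have "(LINT x|lborel. cis (2 * pi * (\<xi> - \<eta>) * x) * of_real (?\<gamma> (x / N)))
          = N *\<^sub>R (LINT x|lborel. cis (2 * pi * N * (\<xi> - \<eta>) * x) * of_real (?\<gamma> x))"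
        using N by (subst lborel_integral_real_affine[where c=N and t=0]) (auto simp: mult_ac)
      also have "\<dots> = of_real (N * exp (- (2 * pi * N * (\<xi> - \<eta>))\<^sup>2 / 2))"
        unfolding integral_cis_std_normal_density by (simp add: scaleR_conv_of_real)
      finally show ?thesis .
    qed
    have "J n = (LINT x|lborel. LINT \<xi>|lborel. \<phi> \<xi> * (cis (2 * pi * (\<xi> - \<eta>) * x) * of_real (?\<gamma> (x / N))))"
    proof -
      have "cis (2 * pi * (\<xi> - \<eta>) * x) = cis (2 * pi * x * \<xi>) * cis (- 2 * pi * x * \<eta>)" for x \<xi>
        unfolding cis_mult by (simp add: algebra_simps)
      then show ?thesis
        unfolding J_def inv_fourier_def N_def
        by (intro Bochner_Integration.integral_cong refl)
           (simp add: mult.assoc[symmetric] del: integral_mult_left_zero flip: integral_mult_left_zero)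
    qed
    also have "\<dots> = (LINT \<xi>|lborel. LINT x|lborel. \<phi> \<xi> * (cis (2 * pi * (\<xi> - \<eta>) * x) * of_real (?\<gamma> (x / N))))"
      by (rule lborel_pair.Fubini_integral[OF int, symmetric])
    also have "\<dots> = (LINT \<xi>|lborel. \<phi> \<xi> * of_real (N * exp (- (2 * pi * N * (\<xi> - \<eta>))\<^sup>2 / 2)))"
      by (simp only: integral_mult_right_zero inner)
    \<comment> \<open>The substitution \<xi> = \<eta> + s / (2 pi N) turns the concentrating
      Gaussian into a fixed one, and its Jacobian cancels the height N. The surviving constant 1 /
      sqrt(2 pi) is the density at 0, which the other limit of \<open>J\<close> carries as
      well.\<close>
    also have "\<dots> = (1 / (2 * pi * N)) *\<^sub>R (LINT s|lborel. \<phi> (\<eta> + 1 / (2 * pi * N) * s) * of_real (N * exp (- s\<^sup>2 / 2)))"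
      using N by (subst lborel_integral_real_affine[where c="1 / (2 * pi * N)" and t=\<eta>]) auto
    also have "(\<lambda>s. \<phi> (\<eta> + 1 / (2 * pi * N) * s) * of_real (N * exp (- s\<^sup>2 / 2))) =
        (\<lambda>s. of_real (N * sqrt (2 * pi)) * (\<phi> (\<eta> + 1 / (2 * pi * N) * s) * of_real (?\<gamma> s)))"
      by (simp add: std_normal_density_def fun_eq_iff)
    also have "(1 / (2 * pi * N)) *\<^sub>R (LINT s|lborel. of_real (N * sqrt (2 * pi)) * (\<phi> (\<eta> + 1 / (2 * pi * N) * s) * of_real (?\<gamma> s)))
       = of_real (1 / (2 * pi * N) * (N * sqrt (2 * pi))) * (LINT s|lborel. (\<phi> (\<eta> + 1 / (2 * pi * N) * s) * of_real (?\<gamma> s)))"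
      by (simp only: integral_mult_right_zero scaleR_conv_of_real of_real_mult mult.assoc)
    also have "1 / (2 * pi * N) * (N * sqrt (2 * pi)) = 1 / sqrt (2 * pi)"
      using N real_sqrt_mult_self[of "2 * pi"] by (simp add: field_simps del: real_sqrt_mult_self)
    finally show ?thesis by (simp add: N_def)
  qed
  have "(\<lambda>n. LINT s|lborel. \<phi> (\<eta> + 1 / (2 * pi * Suc n) * s) * of_real (?\<gamma> s)) \<longlonglongrightarrow> (LINT s|lborel. \<phi> \<eta> * of_real (?\<gamma> s))"
  proof (rule integral_dominated_convergence[where w="\<lambda>s. B * ?\<gamma> s"])
    show "AE s in lborel. (\<lambda>n. \<phi> (\<eta> + 1 / (2 * pi * Suc n) * s) * of_real (?\<gamma> s)) \<longlonglongrightarrow> \<phi> \<eta> * of_real (?\<gamma> s)"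
    proof (intro AE_I2 tendsto_intros)
      fix s :: real
      have "(\<lambda>n. \<eta> + 1 / (2 * pi * Suc n) * s) \<longlonglongrightarrow> \<eta>" by real_asymp
      moreover have "isCont \<phi> \<eta>"
        using smooth_continuous_on[OF test_smooth[OF \<phi>], of UNIV] by (simp add: continuous_on_eq_continuous_at)
      ultimately show "(\<lambda>n. \<phi> (\<eta> + 1 / (2 * pi * Suc n) * s)) \<longlonglongrightarrow> \<phi> \<eta>"
        using isCont_tendsto_compose by blast
    qed
  qed (use \<gamma>_int \<gamma>_le B in \<open>auto simp: norm_mult intro!: mult_right_mono\<close>)
  moreover have "(LINT s|lborel. \<phi> \<eta> * complex_of_real (?\<gamma> s)) = \<phi> \<eta>"
    using integral_cis_std_normal_density[of 0] by simp
  ultimately have "J \<longlonglongrightarrow> 1 / sqrt (2 * pi) * \<phi> \<eta>"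
    unfolding J by (intro tendsto_intros) auto
  with lim1 have "fourier (inv_fourier \<phi>) \<eta> * of_real (?\<gamma> 0) = 1 / sqrt (2 * pi) * \<phi> \<eta>"
    using LIMSEQ_unique by blast
  then show "fourier (inv_fourier \<phi>) \<eta> = \<phi> \<eta>" by (simp add: \<gamma>0)
qed

lemma inv_fourier_in_P_class:
  assumes "test A \<phi>" shows "inv_fourier \<phi> \<in> P_class"
proof -
  have "\<phi> \<xi> = 0" if "\<xi> \<notin> {-A..A}" for \<xi>
    using assms that by (auto simp: test_def)
  then have "{\<xi>. \<phi> \<xi> \<noteq> 0} \<subseteq> {-A..A}" by blast
  then have "compact (closure {\<xi>. \<phi> \<xi> \<noteq> 0})"
    by (meson bounded_closed_interval bounded_subset compact_closure)
  then show ?thesis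
    using assms by (simp add: P_class_def schwartz_inv_fourier fourier_inv_fourier smooth_continuous_on test_smooth)
qed

section \<open>Separated sums of translates\<close>

text \<open>Translations are modulations on the frequency side. The sum of modulations is a smooth
  factor, so a train is again a test function with the same radius, and \<open>inv_fourier\<close>
  turns it into the sum of translates.\<close>

definition train :: "(real \<Rightarrow> complex) \<Rightarrow> nat \<Rightarrow> real \<Rightarrow> real \<Rightarrow> complex" where
  "train \<phi> N L \<xi> = \<phi> \<xi> * (\<Sum>j<N. cis (- 2 * pi * L * 2 ^ j * \<xi>))"

lemma test_train: "test A \<phi> \<Longrightarrow> test A (train \<phi> N L)"
  unfolding train_def[abs_def] by (intro test_mult_smooth smooth_sum smooth_cis)

lemma inv_fourier_train:
  assumes "test A \<phi>"
  shows "inv_fourier (train \<phi> N L) x = (\<Sum>j<N. inv_fourier \<phi> (x - L * 2 ^ j))"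
proof -
  have "train \<phi> N L \<xi> * cis (2 * pi * x * \<xi>) = (\<Sum>j<N. \<phi> \<xi> * cis (2 * pi * (x - L * 2 ^ j) * \<xi>))" for \<xi>
    by (simp add: train_def sum_distrib_left sum_distrib_right mult.assoc cis_mult)
       (simp add: algebra_simps)
  then show ?thesis
    unfolding inv_fourier_def
    by (simp only:) (intro Bochner_Integration.integral_sum test_integrable_cis[OF assms])
qed

text \<open>Distinct powers of two differ by at least 1, so at most one centre lies closer than L/2
  to x, and its term is at most D. Every other term is at most 2D/L by the decay bound, and at most
  N \<le> L of them add up to at most 2D.\<close>

lemma separated_sum_le:
  fixes h :: "real \<Rightarrow> real"
  assumes h: "\<And>y. h y \<le> D" "\<And>y. \<bar>y\<bar> * h y \<le> D" and D: "D \<ge> 0"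
    and N: "N \<ge> 1" "real N \<le> L"
  shows "(\<Sum>j<N. h (x - L * 2 ^ j)) \<le> 3 * D"
proof -
  define S where "S = {j\<in>{..<N}. \<bar>x - L * 2 ^ j\<bar> < L / 2}"
  have L: "L > 0" using N by linarith
  have "j = k" if "\<bar>x - L * 2 ^ j\<bar> < L / 2" "\<bar>x - L * 2 ^ k\<bar> < L / 2" for j k :: nat
  proof (rule ccontr)
    assume "j \<noteq> k"
    have "\<bar>L * 2 ^ j - L * 2 ^ k\<bar> < L" using that by linarith
    then have "L * \<bar>2 ^ j - 2 ^ k\<bar> < L * 1"
      using L by (simp add: abs_mult flip: right_diff_distrib)
    then have "\<bar>(2::real) ^ j - 2 ^ k\<bar> < 1" using L by (simp only: mult_less_cancel_left_pos)
    then have "real_of_int \<bar>2 ^ j - 2 ^ k\<bar> < of_int 1" by simp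
    then have "\<bar>(2::int) ^ j - 2 ^ k\<bar> < 1" by (simp only: of_int_less_iff)
    then have "(2::int) ^ j = 2 ^ k" by linarith
    with \<open>j \<noteq> k\<close> show False by simp
  qed
  then have "card S \<le> Suc 0"
    by (auto simp: S_def card_le_Suc0_iff_eq)
  have "h (x - L * 2 ^ j) \<le> 2 * D / L + (if j \<in> S then D else 0)" if "j < N" for j
  proof (cases "j \<in> S")
    case True
    then show ?thesis using h(1)[of "x - L * 2 ^ j"] D L by (simp add: add_increasing)
  next
    case False
    define y where "y = x - L * 2 ^ j"
    have y: "L / 2 \<le> \<bar>y\<bar>" using False that by (auto simp: S_def y_def)
    have "h y \<le> 2 * D / L"
    proof (cases "h y \<le> 0")
      case False
      then have "L / 2 * h y \<le> \<bar>y\<bar> * h y" using y by (intro mult_right_mono) auto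
      with h(2)[of y] have "L / 2 * h y \<le> D" by linarith
      then show ?thesis using L by (simp add: field_simps)
    qed (use D L in \<open>simp add: order.trans\<close>)
    then show ?thesis using False by (simp add: y_def)
  qed
  then have "(\<Sum>j<N. h (x - L * 2 ^ j)) \<le> (\<Sum>j<N. 2 * D / L + (if j \<in> S then D else 0))"
    by (intro sum_mono) auto
  also have "\<dots> = N * (2 * D / L) + D * card S"
    by (simp add: sum.distrib sum.If_cases S_def Int_def)
  also have "\<dots> \<le> L * (2 * D / L) + D * 1"
    using N D L \<open>card S \<le> Suc 0\<close> by (intro add_mono mult_right_mono mult_left_mono) auto
  also have "\<dots> = 3 * D" using L by simp
  finally show ?thesis .
qed

text \<open>The translates overlap through their tails, so p-th powers of norms do not simply add.
  For finite p = r the estimate |g|^r \<le> (3D)^(r-1) * |g| is used instead; the L1 norm of g is at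
  most N times that of one translate.\<close>

lemma Lp_norm_train:
  assumes \<phi>: "test A \<phi>" and p: "1 \<le> p"
  obtains K where "K \<ge> 0" "\<And>N L. N \<ge> 1 \<Longrightarrow> real N \<le> L \<Longrightarrow>
    Lp_norm p (inv_fourier (train \<phi> N L)) \<le> ennreal (K * N powr enn2real (1 / p))"
proof -
  let ?f = "inv_fourier \<phi>"
  obtain D where D: "D \<ge> 0" "\<And>x. norm (?f x) \<le> D" "\<And>x. \<bar>x\<bar> * norm (?f x) \<le> D"
    using inv_fourier_bound[OF \<phi>] by metis
  have sup: "norm (inv_fourier (train \<phi> N L) x) \<le> 3 * D" if "N \<ge> 1" "real N \<le> L" for N L x
    unfolding inv_fourier_train[OF \<phi>]
    by (rule order.trans[OF norm_sum separated_sum_le[where h="\<lambda>y. norm (?f y)", OF D(2,3,1) that]])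
  show thesis
  proof (cases "p = \<infinity>")
    case True
    show thesis
    proof (rule that[of "3 * D"])
      fix N :: nat and L :: real assume NL: "N \<ge> 1" "real N \<le> L"
      have "Inf {C. AE x in lborel. ennreal (norm (inv_fourier (train \<phi> N L) x)) \<le> C} \<le> ennreal (3 * D)"
        by (rule Inf_lower) (auto intro!: ennreal_leI sup[OF NL])
      \<comment> \<open>Here \<open>enn2real (1 / p)\<close> is 0, and N \<ge> 1 makes the power of
        N equal to 1.\<close>
      then show "Lp_norm p (inv_fourier (train \<phi> N L)) \<le> ennreal (3 * D * N powr enn2real (1 / p))"
        using NL True by (simp add: Lp_norm_def)
    qed (use D in auto)
  next
    case False
    define r where "r = enn2real p"
    have pr: "p = ennreal r" using False by (simp add: r_def less_top)
    have r: "r \<ge> 1" using p unfolding pr by simp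
    have pinv: "enn2real (1 / p) = 1 / r"
      using r divide_ennreal[of 1 r] by (simp add: pr)
    define S where "S = (LINT x|lborel. norm (?f x))"
    have S: "S \<ge> 0" by (simp add: S_def)
    define Q where "Q = (3 * D) powr (r - 1) * S"
    have Q: "Q \<ge> 0" using S by (simp add: Q_def)
    show thesis
    proof (rule that[of "Q powr (1 / r)"])
      fix N :: nat and L :: real assume NL: "N \<ge> 1" "real N \<le> L"
      let ?g = "inv_fourier (train \<phi> N L)"
      have int: "integrable lborel (\<lambda>x. norm (?f (x - L * 2 ^ j)))" for j
        using lborel_integrable_real_affine[OF integrable_norm[OF inv_fourier_integrable[OF \<phi>]], of 1 "- (L * 2 ^ j)"]
        by (simp add: algebra_simps)
      have S': "(LINT x|lborel. norm (?f (x - L * 2 ^ j))) = S" for j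
        unfolding S_def using lborel_integral_real_affine[of 1 "\<lambda>x. norm (?f x)" "- (L * 2 ^ j)"] by (simp add: algebra_simps)
      have "(\<integral>\<^sup>+ x. ennreal (norm (?g x) powr r) \<partial>lborel) \<le>
          (\<integral>\<^sup>+ x. ennreal ((3 * D) powr (r - 1) * (\<Sum>j<N. norm (?f (x - L * 2 ^ j)))) \<partial>lborel)"
      proof (intro nn_integral_mono ennreal_leI)
        fix x
        have "norm (?g x) powr r = norm (?g x) powr (r - 1) * norm (?g x)"
          by (cases "?g x = 0") (simp_all add: powr_diff)
        also have "\<dots> \<le> (3 * D) powr (r - 1) * (\<Sum>j<N. norm (?f (x - L * 2 ^ j)))"
          using r sup[OF NL, of x] unfolding inv_fourier_train[OF \<phi>]
          by (intro mult_mono powr_mono2 norm_sum) auto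
        finally show "norm (?g x) powr r \<le> (3 * D) powr (r - 1) * (\<Sum>j<N. norm (?f (x - L * 2 ^ j)))" .
      qed
      also have "\<dots> = ennreal (LINT x|lborel. (3 * D) powr (r - 1) * (\<Sum>j<N. norm (?f (x - L * 2 ^ j))))"
        using int by (intro nn_integral_eq_integral) (auto intro!: AE_I2 mult_nonneg_nonneg sum_nonneg)
      also have "(LINT x|lborel. (3 * D) powr (r - 1) * (\<Sum>j<N. norm (?f (x - L * 2 ^ j)))) = N * Q"
        using int by (simp add: Bochner_Integration.integral_sum S' Q_def)
      finally have I: "(\<integral>\<^sup>+ x. ennreal (norm (?g x) powr r) \<partial>lborel) \<le> ennreal (N * Q)" .
      then have "enn2real (\<integral>\<^sup>+ x. ennreal (norm (?g x) powr r) \<partial>lborel) powr (1 / r) \<le> (N * Q) powr (1 / r)"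
        using r Q by (intro powr_mono2 enn2real_leI) auto
      \<comment> \<open>Excludes the infinite branch of \<open>Lp_norm\<close>;
        \<open>enn2real\<close> alone would turn an infinite integral into 0.\<close>
      moreover have "(\<integral>\<^sup>+ x. ennreal (norm (?g x) powr r) \<partial>lborel) \<noteq> \<infinity>"
        using I by (metis ennreal_less_top infinity_ennreal_def leD)
      ultimately show "Lp_norm p ?g \<le> ennreal (Q powr (1 / r) * N powr enn2real (1 / p))"
        using False Q unfolding Lp_norm_def pinv
        by (simp add: Let_def powr_mult mult.commute ennreal_leI flip: r_def)
    qed auto
  qed
qed

section \<open>The bilinear operator in sheared coordinates\<close>

text \<open>For fixed \<eta> the map is a translation in the other variable, so Tonelli with the
  t-integral inside gives invariance.\<close>

lemma nn_integral_shear: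
  assumes [measurable]: "f \<in> borel_measurable (lborel \<Otimes>\<^sub>M (lborel :: real measure))"
  shows "(\<integral>\<^sup>+ z. f (snd z + fst z :: real, snd z) \<partial>(lborel \<Otimes>\<^sub>M lborel)) = (\<integral>\<^sup>+ z. f z \<partial>(lborel \<Otimes>\<^sub>M lborel))"
proof -
  have "(\<integral>\<^sup>+ z. f (snd z + fst z, snd z) \<partial>(lborel \<Otimes>\<^sub>M lborel)) = (\<integral>\<^sup>+ \<eta>. \<integral>\<^sup>+ t. f (\<eta> + t, \<eta>) \<partial>lborel \<partial>lborel)"
    by (subst lborel_pair.nn_integral_snd[symmetric]) auto
  also have "\<dots> = (\<integral>\<^sup>+ \<eta>. \<integral>\<^sup>+ \<xi>. f (\<xi>, \<eta>) \<partial>lborel \<partial>lborel)"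
  proof (rule nn_integral_cong)
    fix \<eta> :: real
    show "(\<integral>\<^sup>+ t. f (\<eta> + t, \<eta>) \<partial>lborel) = (\<integral>\<^sup>+ \<xi>. f (\<xi>, \<eta>) \<partial>lborel)"
      by (subst (2) nn_integral_real_affine[where c=1 and t=\<eta>]) auto
  qed
  also have "\<dots> = (\<integral>\<^sup>+ z. f z \<partial>(lborel \<Otimes>\<^sub>M lborel))"
    by (rule lborel_pair.nn_integral_snd) simp
  finally show ?thesis .
qed

text \<open>As an equality of measures the change of variables serves Bochner integrals,
  integrability and almost-everywhere statements alike.\<close>

lemma distr_shear:
  "distr (lborel \<Otimes>\<^sub>M lborel) (lborel \<Otimes>\<^sub>M lborel) (\<lambda>z. (snd z + fst z :: real, snd z)) = lborel \<Otimes>\<^sub>M lborel"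
proof (rule measure_eqI)
  fix X assume "X \<in> sets (distr (lborel \<Otimes>\<^sub>M lborel) (lborel \<Otimes>\<^sub>M lborel) (\<lambda>z. (snd z + fst z :: real, snd z)))"
  then have X [measurable]: "X \<in> sets (lborel \<Otimes>\<^sub>M lborel)" by simp
  have "emeasure (distr (lborel \<Otimes>\<^sub>M lborel) (lborel \<Otimes>\<^sub>M lborel) (\<lambda>z. (snd z + fst z, snd z))) X
      = (\<integral>\<^sup>+ z. indicator X z \<partial>(distr (lborel \<Otimes>\<^sub>M lborel) (lborel \<Otimes>\<^sub>M lborel) (\<lambda>z. (snd z + fst z, snd z))))"
    by (rule nn_integral_indicator[symmetric]) (simp only: sets_distr X)
  also have "\<dots> = (\<integral>\<^sup>+ z. indicator X (snd z + fst z, snd z) \<partial>(lborel \<Otimes>\<^sub>M lborel))"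
    by (subst nn_integral_distr) auto
  also have "\<dots> = emeasure (lborel \<Otimes>\<^sub>M lborel) X"
    by (subst nn_integral_shear) (simp, rule nn_integral_indicator[OF X])
  finally show "emeasure (distr (lborel \<Otimes>\<^sub>M lborel) (lborel \<Otimes>\<^sub>M lborel) (\<lambda>z. (snd z + fst z :: real, snd z))) X = emeasure (lborel \<Otimes>\<^sub>M lborel) X" .
qed simp

lemma integral_shear:
  fixes f :: "real \<times> real \<Rightarrow> complex"
  assumes "f \<in> borel_measurable (lborel \<Otimes>\<^sub>M lborel)"
  shows "(LINT z|(lborel \<Otimes>\<^sub>M lborel). f z) = (LINT z|(lborel \<Otimes>\<^sub>M lborel). f (snd z + fst z, snd z))"
  by (subst distr_shear[symmetric], subst integral_distr) (use assms in auto)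

text \<open>For j < k the sum 2^j + 2^k lies strictly between 2^k and 2^(k+1), so it is no power of
  two.\<close>

lemma power2_Sidon:
  assumes "(2::real) ^ j + 2 ^ k = 2 * 2 ^ i"
  shows "j = i \<and> k = i"
proof -
  have "j = k"
  proof (rule ccontr)
    have *: False if "j < k" "(2::real) ^ j + 2 ^ k = 2 ^ Suc i" for j k :: nat
    proof -
      have "(2::real) ^ j < 2 ^ k" "(0::real) < 2 ^ j" using that by simp_all
      then have "(2::real) ^ k < 2 ^ Suc i" "(2::real) ^ Suc i < 2 ^ Suc k"
        using that(2) unfolding power_Suc by linarith+
      then have "k < Suc i" "Suc i < Suc k" by (simp_all only: power_strict_increasing_iff)
      then show False by simp
    qed
    assume "j \<noteq> k"
    with *[of j k] *[of k j] assms show False by (auto simp: add.commute neq_iff)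
  qed
  with assms show ?thesis by simp
qed

section \<open>The operator of a locally integrable symbol in the coordinates (t, \<eta>)\<close>

locale loc_integrable =
  fixes M :: "real \<Rightarrow> complex"
  assumes meas [measurable]: "M \<in> borel_measurable lborel"
    and loc: "\<And>K. compact K \<Longrightarrow> set_integrable lborel K M"
begin

lemma integrable_window: "integrable lborel (\<lambda>t. indicator {-a..a} t *\<^sub>R M t)"
  using loc[of "{-a..a}"] by (simp add: set_integrable_def)

text \<open>If |\<eta>| < A and |\<eta> + t| < A, then |t| < 2A. Hence \<open>M\<close> enters only
  through its restriction to a compact window, where it is integrable.\<close>

lemma shifted_product_support:
  assumes "test A \<phi>" "test A \<psi>"
  shows "\<phi> (\<eta> + t) * \<psi> \<eta> * M t = \<phi> (\<eta> + t) * (indicator {-2*A..2*A} t *\<^sub>R M t * \<psi> \<eta>)"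
proof (cases "A \<le> \<bar>\<eta>\<bar> \<or> A \<le> \<bar>\<eta> + t\<bar>")
  case True
  with assms show ?thesis by (auto simp: test_def)
next
  case False
  then have "t \<in> {-2*A..2*A}" by auto
  then show ?thesis by simp
qed

text \<open>Bounding the shifted factor \<phi> by a constant leaves a product of an integrable
  function of t and one of \<eta>.\<close>

lemma integrable_sheared:
  assumes "test A \<phi>" "test A \<psi>"
  shows "integrable (lborel \<Otimes>\<^sub>M lborel) (\<lambda>z. \<phi> (snd z + fst z) * \<psi> (snd z) * M (fst z))"
proof -
  note [measurable] = test_measurable[OF assms(1)] test_measurable[OF assms(2)]
  obtain B where B: "B \<ge> 0" "\<And>x. norm (\<phi> x) \<le> B" using test_bounded[OF assms(1)] by metis
  have "integrable (lborel \<Otimes>\<^sub>M lborel) (\<lambda>z. (indicator {-2*A..2*A} (fst z) *\<^sub>R M (fst z)) * \<psi> (snd z))"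
    using integrable_window[of "2*A"] test_integrable[OF assms(2)] by (intro integrable_pair_mult) auto
  then have i: "integrable (lborel \<Otimes>\<^sub>M lborel) (\<lambda>z. B * norm ((indicator {-2*A..2*A} (fst z) *\<^sub>R M (fst z)) * \<psi> (snd z)))"
    by (intro integrable_mult_right integrable_norm)
  have bd: "norm (\<phi> (snd z + fst z) * \<psi> (snd z) * M (fst z))
      \<le> norm (B * norm ((indicator {-2*A..2*A} (fst z) *\<^sub>R M (fst z)) * \<psi> (snd z)))" for z
    unfolding shifted_product_support[OF assms] norm_mult[of "\<phi> _"] abs_mult real_norm_def abs_norm_cancel
    using B by (intro mult_right_mono) (auto intro: order.trans)
  show ?thesis
    by (rule Bochner_Integration.integrable_bound[OF i _ AE_I2[OF bd]]) measurable
qed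

text \<open>The frequencies u, dual to t, and w, dual to \<eta>, are kept independent. A single
  operator value uses only w = 2u, but translating f and g by different amounts shifts the two
  separately.\<close>

definition osc :: "(real \<Rightarrow> complex) \<Rightarrow> (real \<Rightarrow> complex) \<Rightarrow> real \<Rightarrow> real \<Rightarrow> complex" where
  "osc \<phi> \<psi> u w = (LINT z|(lborel \<Otimes>\<^sub>M lborel).
     \<phi> (snd z + fst z) * \<psi> (snd z) * M (fst z) * (cis (2 * pi * u * fst z) * cis (2 * pi * w * snd z)))"

lemma integrable_osc:
  assumes "test A \<phi>" "test A \<psi>"
  shows "integrable (lborel \<Otimes>\<^sub>M lborel)
     (\<lambda>z. \<phi> (snd z + fst z) * \<psi> (snd z) * M (fst z) * (cis (2 * pi * u * fst z) * cis (2 * pi * w * snd z)))"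
proof -
  note [measurable] = test_measurable[OF assms(1)] test_measurable[OF assms(2)]
  show ?thesis
    by (rule Bochner_Integration.integrable_bound[OF integrable_sheared[OF assms]])
       (auto simp: norm_mult cis_conv_exp)
qed

lemma bilin_op_sheared:
  assumes "test A \<phi>" "test A \<psi>"
  shows "bilin_op M (inv_fourier \<phi>) (inv_fourier \<psi>) x = (LINT z|(lborel \<Otimes>\<^sub>M lborel).
     \<phi> (snd z + fst z) * \<psi> (snd z) * M (fst z) * cis (2 * pi * (snd z + fst z + snd z) * x))"
proof -
  note [measurable] = test_measurable[OF assms(1)] test_measurable[OF assms(2)]
  show ?thesis
    unfolding bilin_op_def fourier_inv_fourier[OF assms(1)] fourier_inv_fourier[OF assms(2)]
    by (subst integral_shear) (simp_all add: cis_conv_exp)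
qed

lemma bilin_op_eq_osc:
  assumes "test A \<phi>" "test A \<psi>"
  shows "bilin_op M (inv_fourier \<phi>) (inv_fourier \<psi>) x = osc \<phi> \<psi> x (2 * x)"
  unfolding bilin_op_sheared[OF assms] osc_def cis_mult
  by (simp add: algebra_simps)

text \<open>The exponent of the (j,k) term, (2\<eta> + t) y - L 2^j (\<eta> + t) - L 2^k \<eta>, is
  regrouped by powers of t and \<eta>.\<close>

lemma bilin_op_trains:
  assumes "test A \<phi>" "test A \<psi>"
  shows "bilin_op M (inv_fourier (train \<phi> N L)) (inv_fourier (train \<psi> N L)) y =
    (\<Sum>j<N. \<Sum>k<N. osc \<phi> \<psi> (y - L * 2 ^ j) (2 * y - L * (2 ^ j + 2 ^ k)))"
proof -
  have "train \<phi> N L (\<eta> + t) * train \<psi> N L \<eta> * M t * cis (2 * pi * (\<eta> + t + \<eta>) * y) =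
    (\<Sum>j<N. \<Sum>k<N. \<phi> (\<eta> + t) * \<psi> \<eta> * M t *
       (cis (2 * pi * (y - L * 2 ^ j) * t) * cis (2 * pi * (2 * y - L * (2 ^ j + 2 ^ k)) * \<eta>)))" for \<eta> t
  proof -
    have phase: "cis (- 2 * pi * L * 2 ^ j * (\<eta> + t)) * cis (- 2 * pi * L * 2 ^ k * \<eta>) * cis (2 * pi * (\<eta> + t + \<eta>) * y)
      = cis (2 * pi * (y - L * 2 ^ j) * t) * cis (2 * pi * (2 * y - L * (2 ^ j + 2 ^ k)) * \<eta>)" for j k :: nat
      unfolding cis_mult by (rule arg_cong[where f=cis]) (simp add: algebra_simps)
    then have "(\<Sum>j<N. \<Sum>k<N. \<phi> (\<eta> + t) * \<psi> \<eta> * M t *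
       (cis (2 * pi * (y - L * 2 ^ j) * t) * cis (2 * pi * (2 * y - L * (2 ^ j + 2 ^ k)) * \<eta>))) =
       (\<Sum>j<N. \<Sum>k<N. (\<phi> (\<eta> + t) * \<psi> \<eta> * M t * cis (2 * pi * (\<eta> + t + \<eta>) * y)) *
         (cis (- 2 * pi * L * 2 ^ j * (\<eta> + t)) * cis (- 2 * pi * L * 2 ^ k * \<eta>)))"
      by (intro sum.cong refl, subst phase[symmetric]) (simp only: mult_ac)
    also have "\<dots> = (\<phi> (\<eta> + t) * \<psi> \<eta> * M t * cis (2 * pi * (\<eta> + t + \<eta>) * y)) *
      ((\<Sum>j<N. cis (- 2 * pi * L * 2 ^ j * (\<eta> + t))) * (\<Sum>k<N. cis (- 2 * pi * L * 2 ^ k * \<eta>)))"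
      by (subst sum_product) (simp only: sum_distrib_left)
    finally show ?thesis
      unfolding train_def by (simp only: mult_ac)
  qed
  then show ?thesis
    unfolding bilin_op_sheared[OF test_train[OF assms(1)] test_train[OF assms(2)]] osc_def
    by (simp only: Bochner_Integration.integral_sum integrable_osc[OF assms] Bochner_Integration.integrable_sum)
qed

text \<open>For fixed t the \<eta>-integral is the inverse transform of \<phi>(\<eta> + t)
  \<psi>(\<eta>) at w, and |w| times it is bounded after one integration by parts; \<open>M\<close>
  is then only an integrable weight in t. Uniformity in u is essential, because u moves with L in
  the application.\<close>

lemma osc_decay:
  assumes "test A \<phi>" "test A \<psi>"
  obtains C where "\<And>u w. \<bar>w\<bar> * norm (osc \<phi> \<psi> u w) \<le> C"
proof -
  note [measurable] = test_measurable[OF assms(1)] test_measurable[OF assms(2)]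
  obtain \<phi>' where d: "\<And>x. (\<phi> has_vector_derivative \<phi>' x) (at x)" "test A \<phi>'"
    using test_derivE[OF assms(1)] by metis
  obtain \<psi>' where e: "\<And>x. (\<psi> has_vector_derivative \<psi>' x) (at x)" "test A \<psi>'"
    using test_derivE[OF assms(2)] by metis
  obtain B where B: "B \<ge> 0" "\<And>x. norm (\<phi> x) \<le> B" using test_bounded[OF assms(1)] by metis
  obtain B' where B': "B' \<ge> 0" "\<And>x. norm (\<phi>' x) \<le> B'" using test_bounded[OF d(2)] by metis
  \<comment> \<open>Majorises the L1 norm of the \<eta>-derivative for all t at once: factors
    containing the shift are replaced by their bounds, and those without it supply
    integrability.\<close>
  define E where "E = (LINT \<eta>|lborel. B' * norm (\<psi> \<eta>) + B * norm (\<psi>' \<eta>))"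
  have Eint: "integrable lborel (\<lambda>\<eta>. B' * norm (\<psi> \<eta>) + B * norm (\<psi>' \<eta>))"
    using test_integrable[OF assms(2)] test_integrable[OF e(2)] by auto
  let ?\<chi> = "\<lambda>t \<eta>. \<phi> (\<eta> + t) * \<psi> \<eta>"
  have bound: "\<bar>w\<bar> * norm (inv_fourier (?\<chi> t) w) \<le> E" for w t
  proof -
    let ?\<chi>' = "\<lambda>\<eta>. \<phi> (\<eta> + t) * \<psi>' \<eta> + \<phi>' (\<eta> + t) * \<psi> \<eta>"
    have sm: "smooth (\<lambda>\<eta>. \<phi> (\<eta> + t))" "smooth (\<lambda>\<eta>. \<phi>' (\<eta> + t))"
      using smooth_affine[of \<phi> t 1] smooth_affine[of \<phi>' t 1] test_smooth assms(1) d(2) by (auto simp: add.commute)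
    \<comment> \<open>The radius A is inherited from \<psi> and its derivative, hence independent of
      the shift t.\<close>
    then have t: "test A (?\<chi> t)" "test A ?\<chi>'"
      using assms(2) e(2) by (auto simp: test_def intro!: smooth_add smooth_mult)
    have "((\<lambda>\<eta>. \<phi> (\<eta> + t)) has_vector_derivative \<phi>' (\<eta> + t)) (at \<eta>)" for \<eta>
    proof -
      have "((\<lambda>\<eta>. \<eta> + t) has_vector_derivative 1) (at \<eta>)"
        by (auto intro!: derivative_eq_intros simp: has_real_derivative_iff_has_vector_derivative[symmetric])
      from vector_diff_chain_at[OF this d(1)] show ?thesis by (simp add: o_def)
    qed
    then have "(?\<chi> t has_vector_derivative ?\<chi>' \<eta>) (at \<eta>)" for \<eta>
      by (intro has_vector_derivative_mult e(1))
    from inv_fourier_by_parts[OF t this, of w]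
    have "norm (2 * pi * w * inv_fourier (?\<chi> t) w) = norm (inv_fourier ?\<chi>' w)"
      by (simp add: norm_mult)
    also have "\<dots> \<le> (LINT \<eta>|lborel. norm (?\<chi>' \<eta>))" by (rule norm_inv_fourier_le)
    also have "\<dots> \<le> E"
      unfolding E_def
    proof (rule integral_mono[OF integrable_norm[OF test_integrable[OF t(2)]] Eint])
      fix \<eta> show "norm (?\<chi>' \<eta>) \<le> B' * norm (\<psi> \<eta>) + B * norm (\<psi>' \<eta>)"
        using mult_right_mono[OF B(2)[of "\<eta> + t"] norm_ge_zero[of "\<psi>' \<eta>"]]
          mult_right_mono[OF B'(2)[of "\<eta> + t"] norm_ge_zero[of "\<psi> \<eta>"]]
          norm_triangle_ineq[of "\<phi> (\<eta> + t) * \<psi>' \<eta>" "\<phi>' (\<eta> + t) * \<psi> \<eta>"]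
        by (simp add: norm_mult)
    qed
    finally have "2 * pi * (\<bar>w\<bar> * norm (inv_fourier (?\<chi> t) w)) \<le> E" by (simp add: norm_mult mult_ac)
    moreover have "1 * (\<bar>w\<bar> * norm (inv_fourier (?\<chi> t) w)) \<le> 2 * pi * (\<bar>w\<bar> * norm (inv_fourier (?\<chi> t) w))"
      using pi_gt3 by (intro mult_right_mono) auto
    ultimately show ?thesis by linarith
  qed
  let ?W = "\<lambda>t. indicator {-2*A..2*A} t *\<^sub>R M t"
  have W: "integrable lborel ?W" using integrable_window[of "2*A"] by simp
  show thesis
  proof (rule that)
    fix u w
    let ?h = "\<lambda>t. ?W t * cis (2 * pi * u * t) * inv_fourier (?\<chi> t) w"
    have h: "(LINT \<eta>|lborel. \<phi> (\<eta> + t) * \<psi> \<eta> * M t * (cis (2 * pi * u * t) * cis (2 * pi * w * \<eta>))) = ?h t" for t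
    proof -
      have "(LINT \<eta>|lborel. \<phi> (\<eta> + t) * \<psi> \<eta> * M t * (cis (2 * pi * u * t) * cis (2 * pi * w * \<eta>))) =
        (LINT \<eta>|lborel. (?W t * cis (2 * pi * u * t)) * (\<phi> (\<eta> + t) * \<psi> \<eta> * cis (2 * pi * w * \<eta>)))"
        unfolding shifted_product_support[OF assms] by (simp only: mult_ac)
      then show ?thesis by (simp only: inv_fourier_def integral_mult_right_zero)
    qed
    have osc: "osc \<phi> \<psi> u w = (LINT t|lborel. ?h t)"
      unfolding osc_def h[symmetric] using lborel_pair.integral_fst'[OF integrable_osc[OF assms, of u w]]
      by (simp only: fst_conv snd_conv)
    have "\<bar>w\<bar> * norm (osc \<phi> \<psi> u w) = norm (LINT t|lborel. of_real w * ?h t)"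
      by (simp only: osc integral_mult_right_zero norm_mult norm_of_real)
    also have "\<dots> \<le> (LINT t|lborel. norm (?W t) * E)"
    proof (rule Bochner_Integration.integral_norm_bound_integral)
      show "norm (of_real w * ?h t) \<le> norm (?W t) * E" for t
        using mult_left_mono[OF bound[of w t] norm_ge_zero[of "?W t"]]
        by (simp add: norm_mult mult_ac)
      have "integrable lborel ?h"
        unfolding h[symmetric]
        using lborel_pair.integrable_fst'[OF integrable_osc[OF assms, of u w]] by (simp only: fst_conv snd_conv)
      then show "integrable lborel (\<lambda>t. of_real w * ?h t)" by (rule integrable_mult_right)
      show "integrable lborel (\<lambda>t. norm (?W t) * E)"
        using W by (intro integrable_mult_left integrable_norm)
    qed
    finally show "\<bar>w\<bar> * norm (osc \<phi> \<psi> u w) \<le> (LINT t|lborel. norm (?W t) * E)" .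
  qed
qed

text \<open>Seen from the i-th position, the pair j = k = i has frequencies x and 2x for every n, so
  its term is constant in n and equal to the limit.\<close>

lemma bilin_op_trains_tendsto:
  assumes "test A \<phi>" "test A \<psi>" "i < N"
  shows "(\<lambda>n. bilin_op M (inv_fourier (train \<phi> N (real n))) (inv_fourier (train \<psi> N (real n))) (x + real n * 2 ^ i))
     \<longlonglongrightarrow> bilin_op M (inv_fourier \<phi>) (inv_fourier \<psi>) x"
proof -
  let ?o = "\<lambda>n j k. osc \<phi> \<psi> (x + real n * 2 ^ i - real n * 2 ^ j) (2 * (x + real n * 2 ^ i) - real n * (2 ^ j + 2 ^ k))"
  let ?b = "bilin_op M (inv_fourier \<phi>) (inv_fourier \<psi>) x"
  obtain C where C: "\<And>u w. \<bar>w\<bar> * norm (osc \<phi> \<psi> u w) \<le> C"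
    using osc_decay[OF assms(1,2)] by metis
  have lim: "(\<lambda>n. ?o n j k) \<longlonglongrightarrow> (if j = i \<and> k = i then ?b else 0)" for j k
  proof (cases "j = i \<and> k = i")
    case True
    then show ?thesis by (simp add: bilin_op_eq_osc[OF assms(1,2)])
  next
    case False
    \<comment> \<open>The rate of drift: the second frequency of the term is 2x + n s.\<close>
    define s where "s = 2 * 2 ^ i - (2 ^ j + 2 ^ k :: real)"
    have s: "s \<noteq> 0" using False power2_Sidon[of j k i] by (auto simp: s_def)
    have "(\<lambda>n. ?o n j k) \<longlonglongrightarrow> 0"
    proof (rule Lim_null_comparison)
      have "filterlim (\<lambda>n. \<bar>2 * x + real n * s\<bar>) at_top sequentially"
        using s by (cases "s > 0") (real_asymp | simp)+
      then have "eventually (\<lambda>n. \<bar>2 * x + real n * s\<bar> > 0) sequentially"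
        unfolding filterlim_at_top_dense by blast
      then show "\<forall>\<^sub>F n in sequentially. norm (?o n j k) \<le> C / \<bar>2 * x + real n * s\<bar>"
      proof eventually_elim
        case (elim n)
        have "2 * (x + real n * 2 ^ i) - real n * (2 ^ j + 2 ^ k) = 2 * x + real n * s"
          by (simp add: s_def algebra_simps)
        with C[of "2 * x + real n * s" "x + real n * 2 ^ i - real n * 2 ^ j"] elim show ?case
          by (simp add: field_simps)
      qed
      show "(\<lambda>n. C / \<bar>2 * x + real n * s\<bar>) \<longlonglongrightarrow> 0"
        using s by (cases "s > 0") (real_asymp | simp)+
    qed
    moreover have "(if j = i \<and> k = i then ?b else 0) = 0" using False by (rule if_not_P)
    ultimately show ?thesis by (simp only:)
  qed
  have "(\<lambda>n. \<Sum>j<N. \<Sum>k<N. ?o n j k) \<longlonglongrightarrow> (\<Sum>j<N. \<Sum>k<N. if j = i \<and> k = i then ?b else 0)"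
    by (intro tendsto_sum lim)
  also have "(\<Sum>j<N. \<Sum>k<N. if j = i \<and> k = i then ?b else 0) = ?b"
  proof -
    have "(\<Sum>k<N. if j = i \<and> k = i then ?b else 0) = (if j = i then ?b else 0)" for j
      using assms(3) by (cases "j = i") auto
    then show ?thesis using assms(3) by simp
  qed
  finally show ?thesis
    unfolding bilin_op_trains[OF assms(1,2)] .
qed

text \<open>Dominated convergence, as x enters only through a factor of modulus 1. Continuity
  supplies measurability and later upgrades vanishing almost everywhere on (0,1) to vanishing at
  each point.\<close>

lemma bilin_op_continuous:
  assumes "test A \<phi>" "test A \<psi>"
  shows "isCont (bilin_op M (inv_fourier \<phi>) (inv_fourier \<psi>)) x"
proof -
  note [measurable] = test_measurable[OF assms(1)] test_measurable[OF assms(2)]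
  have "(\<lambda>n. bilin_op M (inv_fourier \<phi>) (inv_fourier \<psi>) (y n)) \<longlonglongrightarrow> bilin_op M (inv_fourier \<phi>) (inv_fourier \<psi>) x"
    if y: "y \<longlonglongrightarrow> x" for y
    unfolding bilin_op_sheared[OF assms]
    by (rule integral_dominated_convergence[OF _ _ integrable_norm[OF integrable_sheared[OF assms]]])
       (auto simp: norm_mult cis_conv_exp intro!: tendsto_intros y)
  then show ?thesis by (simp add: continuous_at_sequentially o_def)
qed

end

section \<open>Vanishing of the operator and of the symbol\<close>

text \<open>Boxes form an intersection-stable generator of the Borel sets. Since f is integrable
  only on boxes, it is first cut to a large box: the total integral is then finite and itself zero,
  as the passage to complements requires. Countably many cuts exhaust the space.\<close>

lemma AE_zero_if_integral_box_zero:
  fixes f :: "'a::euclidean_space \<Rightarrow> complex"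
  assumes int: "\<And>a b. integrable lborel (\<lambda>x. indicator (box a b) x *\<^sub>R f x)"
    and zero: "\<And>a b. (LINT x|lborel. indicator (box a b) x *\<^sub>R f x) = 0"
  shows "AE x in lborel. f x = 0"
proof -
  have "AE x in lborel. indicator (box (- (real n *\<^sub>R One)) (real n *\<^sub>R One)) x *\<^sub>R f x = 0" for n :: nat
  proof (rule sigma_finite_measure.density_zero[OF lborel.sigma_finite_measure_axioms])
    let ?B = "box (- (real n *\<^sub>R One)) (real n *\<^sub>R One) :: 'a set"
    let ?g = "\<lambda>x. indicator ?B x *\<^sub>R f x"
    let ?G = "range (\<lambda>(a, b). box a b) :: 'a set set"
    show g: "integrable lborel ?g" by (rule int)
    have gi: "set_integrable lborel A ?g" if "A \<in> sets borel" for A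
      unfolding set_integrable_def by (rule integrable_mult_indicator[OF _ g]) (use that in simp)
    have G: "Int_stable ?G" "?G \<subseteq> Pow UNIV"
      by (auto simp: Int_stable_def box_Int_box)
    fix A :: "'a set" assume "A \<in> sets lborel"
    then have "A \<in> sigma_sets UNIV ?G"
      by (simp add: borel_eq_box sets_measure_of[OF G(2)])
    with G show "set_lebesgue_integral lborel A ?g = 0"
    proof (induction rule: sigma_sets_induct_disjoint)
      case (basic A)
      then obtain a b where A: "A = box a b" by auto
      obtain c d where cd: "A \<inter> ?B = box c d" unfolding A box_Int_box by blast
      have "set_lebesgue_integral lborel A ?g = (LINT x|lborel. indicator (A \<inter> ?B) x *\<^sub>R f x)"
        unfolding set_lebesgue_integral_def by (intro Bochner_Integration.integral_cong) (auto simp: indicator_def)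
      then show ?case unfolding cd zero .
    next
      case empty
      then show ?case by (simp add: set_lebesgue_integral_def)
    next
      case (compl A)
      then have [measurable]: "A \<in> sets borel"
        by (simp add: borel_eq_box sets_measure_of[OF G(2)])
      have "set_lebesgue_integral lborel (A \<union> (UNIV - A)) ?g = set_lebesgue_integral lborel A ?g + set_lebesgue_integral lborel (UNIV - A) ?g"
        by (intro set_integral_Un gi) auto
      moreover have "set_lebesgue_integral lborel UNIV ?g = 0"
        using zero by (simp add: set_lebesgue_integral_def)
      ultimately show ?case using compl by simp
    next
      case (union A)
      then have [measurable]: "A i \<in> sets borel" for i
        by (auto simp: borel_eq_box sets_measure_of[OF G(2)])
      have "set_lebesgue_integral lborel (\<Union>i. A i) ?g = (\<Sum>i. set_lebesgue_integral lborel (A i) ?g)"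
        using union(1) by (intro lebesgue_integral_countable_add gi) (auto simp: disjoint_family_on_def)
      also have "\<dots> = 0" using union by simp
      finally show ?case .
    qed
  qed
  then have "AE x in lborel. \<forall>n::nat. indicator (box (- (real n *\<^sub>R One)) (real n *\<^sub>R One)) x *\<^sub>R f x = 0"
    unfolding AE_all_countable by blast
  then show ?thesis
  proof eventually_elim
    case (elim x)
    obtain n :: nat where "x \<in> box (- (real n *\<^sub>R One)) (real n *\<^sub>R One)"
      using UN_box_eq_UNIV by blast
    with elim[rule_format, of n] show ?case by simp
  qed
qed

text \<open>The open unit intervals starting at the points \<open>c i\<close> are pairwise disjoint,
  so after shifting each y is counted at most once.\<close>

lemma sum_nn_integral_shifts_le:
  fixes h :: "real \<Rightarrow> ennreal" and c :: "nat \<Rightarrow> real"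
  assumes [measurable]: "h \<in> borel_measurable borel"
    and sep: "\<And>i j. i \<noteq> j \<Longrightarrow> 1 \<le> \<bar>c i - c j\<bar>"
  shows "(\<integral>\<^sup>+ x. (\<Sum>i<N. h (x + c i)) * indicator {0<..<1} x \<partial>lborel) \<le> (\<integral>\<^sup>+ x. h x \<partial>lborel)"
proof -
  have "(\<integral>\<^sup>+ x. (\<Sum>i<N. h (x + c i)) * indicator {0<..<1} x \<partial>lborel)
      = (\<Sum>i<N. \<integral>\<^sup>+ x. h (x + c i) * indicator {0<..<1} x \<partial>lborel)"
    unfolding sum_distrib_right by (rule nn_integral_sum) measurable
  also have "\<dots> = (\<Sum>i<N. \<integral>\<^sup>+ y. h y * indicator {0<..<1} (y - c i) \<partial>lborel)"
  proof (rule sum.cong[OF refl])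
    fix i
    show "(\<integral>\<^sup>+ x. h (x + c i) * indicator {0<..<1} x \<partial>lborel) = (\<integral>\<^sup>+ y. h y * indicator {0<..<1} (y - c i) \<partial>lborel)"
      by (subst (2) nn_integral_real_affine[where c=1 and t="c i"]) (auto simp: add.commute)
  qed
  also have "\<dots> = (\<integral>\<^sup>+ y. (\<Sum>i<N. h y * indicator {0<..<1} (y - c i)) \<partial>lborel)"
    by (rule nn_integral_sum[symmetric]) measurable
  also have "\<dots> \<le> (\<integral>\<^sup>+ y. h y \<partial>lborel)"
  proof (rule nn_integral_mono)
    fix y
    have "i = j" if "y - c i \<in> {0<..<1}" "y - c j \<in> {0<..<1}" for i j
      using sep[of i j] that by (cases "i = j") auto
    then have "card {i\<in>{..<N}. y - c i \<in> {0<..<1}} \<le> Suc 0"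
      by (auto simp: card_le_Suc0_iff_eq)
    then have "of_nat (card {i\<in>{..<N}. y - c i \<in> {0<..<1}}) \<le> (1::ennreal)"
      by (metis One_nat_def of_nat_1 of_nat_mono)
    moreover have "(\<Sum>i<N. indicator {0<..<1} (y - c i) :: ennreal) = of_nat (card {i\<in>{..<N}. y - c i \<in> {0<..<1}})"
      by (simp add: indicator_def sum.If_cases Int_def)
    ultimately show "(\<Sum>i<N. h y * indicator {0<..<1} (y - c i)) \<le> h y"
      unfolding sum_distrib_left[symmetric] by (metis mult.right_neutral mult_left_mono zero_le)
  qed
  finally show ?thesis .
qed

lemma Lp_norm_le_imp_nn_integral_le:
  assumes q: "q \<ge> 1" and "Lp_norm (ennreal q) f \<le> ennreal R" "R \<ge> 0"
  shows "(\<integral>\<^sup>+ x. ennreal (norm (f x) powr q) \<partial>lborel) \<le> ennreal (R powr q)"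
proof -
  define I where "I = (\<integral>\<^sup>+ x. ennreal (norm (f x) powr q) \<partial>lborel)"
  have r: "enn2real (ennreal q) = q" using q by simp
  have *: "(if I = \<infinity> then \<infinity> else ennreal (enn2real I powr (1 / q))) \<le> ennreal R"
    using assms(2) r by (simp only: Lp_norm_def I_def Let_def infinity_ennreal_def ennreal_neq_top if_False)
  \<comment> \<open>As R is finite, the infinite branch is impossible and \<open>enn2real\<close>
    loses nothing.\<close>
  then have fin: "I \<noteq> \<infinity>" by (auto simp: top_unique)
  with * have "enn2real I powr (1 / q) \<le> R" using assms(3) by simp
  then have "(enn2real I powr (1 / q)) powr q \<le> R powr q"
    using q by (intro powr_mono2) auto
  then have "enn2real I \<le> R powr q" using q by (simp add: powr_powr)
  then have "ennreal (enn2real I) \<le> ennreal (R powr q)" by (rule ennreal_leI)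
  with fin show ?thesis unfolding I_def[symmetric] by (cases I) auto
qed

section \<open>From the norm inequality to the vanishing of operator and symbol\<close>

context loc_integrable
begin

text \<open>At fixed N, Fatou gives N * \<Gamma> \<le> (Q * N^\<theta>)^q, where \<Gamma> is the
  integral over (0,1) alone, so that the N shifted windows are disjoint. Hence \<Gamma> \<le> Q^q *
  N^(q \<theta> - 1), and the strict inequality between the exponents makes the power of N
  negative.\<close>

lemma bilin_op_zero_of_bound:
  assumes \<phi>: "test A \<phi>" and \<psi>: "test A \<psi>" and p: "1 \<le> p1" "1 \<le> p2" and q: "1 \<le> q"
    and less: "enn2real (1 / p1) + enn2real (1 / p2) < 1 / q"
    and bound: "\<And>f g. f \<in> P_class \<Longrightarrow> g \<in> P_class \<Longrightarrow>
       Lp_norm (ennreal q) (bilin_op M f g) \<le> ennreal C * Lp_norm p1 f * Lp_norm p2 g"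
    and x: "x \<in> {0<..<1}"
  shows "bilin_op M (inv_fourier \<phi>) (inv_fourier \<psi>) x = 0"
proof -
  define g where "g = bilin_op M (inv_fourier \<phi>) (inv_fourier \<psi>)"
  define B where "B N n = bilin_op M (inv_fourier (train \<phi> N (real n))) (inv_fourier (train \<psi> N (real n)))" for N n :: nat
  define \<theta> where "\<theta> = enn2real (1 / p1) + enn2real (1 / p2)"
  have g_cont: "continuous_on UNIV g"
    unfolding g_def by (intro continuous_at_imp_continuous_on ballI bilin_op_continuous[OF \<phi> \<psi>])
  then have [measurable]: "g \<in> borel_measurable borel" by (rule borel_measurable_continuous_onI)
  have [measurable]: "B N n \<in> borel_measurable borel" for N n
    unfolding B_def by (intro borel_measurable_continuous_onI continuous_at_imp_continuous_on ballI
      bilin_op_continuous[OF test_train[OF \<phi>] test_train[OF \<psi>]])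
  obtain K1 where K1: "K1 \<ge> 0" "\<And>N L. N \<ge> 1 \<Longrightarrow> real N \<le> L \<Longrightarrow>
    Lp_norm p1 (inv_fourier (train \<phi> N L)) \<le> ennreal (K1 * N powr enn2real (1 / p1))"
    using Lp_norm_train[OF \<phi> p(1)] by metis
  obtain K2 where K2: "K2 \<ge> 0" "\<And>N L. N \<ge> 1 \<Longrightarrow> real N \<le> L \<Longrightarrow>
    Lp_norm p2 (inv_fourier (train \<psi> N L)) \<le> ennreal (K2 * N powr enn2real (1 / p2))"
    using Lp_norm_train[OF \<psi> p(2)] by metis
  \<comment> \<open>A negative \<open>C\<close> is read as 0 by \<open>ennreal\<close>;
    \<open>max 0 C\<close> is that constant as a nonnegative real.\<close>
  define Q where "Q = max 0 C * (K1 * K2)"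
  have Q: "Q \<ge> 0" using K1 K2 by (simp add: Q_def)
  have upper: "(\<integral>\<^sup>+ y. ennreal (norm (B N n y) powr q) \<partial>lborel) \<le> ennreal ((Q * N powr \<theta>) powr q)"
    if "N \<ge> 1" "n \<ge> N" for N n :: nat
  proof (rule Lp_norm_le_imp_nn_integral_le[OF q])
    have "Lp_norm (ennreal q) (B N n) \<le> ennreal C * Lp_norm p1 (inv_fourier (train \<phi> N n)) * Lp_norm p2 (inv_fourier (train \<psi> N n))"
      unfolding B_def by (rule bound[OF inv_fourier_in_P_class[OF test_train[OF \<phi>]] inv_fourier_in_P_class[OF test_train[OF \<psi>]]])
    also have "\<dots> \<le> ennreal (max 0 C) * ennreal (K1 * N powr enn2real (1 / p1)) * ennreal (K2 * N powr enn2real (1 / p2))"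
      using that by (intro mult_mono K1 K2 ennreal_leI) auto
    also have "\<dots> = ennreal (Q * N powr \<theta>)"
      using K1 K2 by (simp add: Q_def \<theta>_def powr_add ennreal_mult' [symmetric] mult_ac)
    finally show "Lp_norm (ennreal q) (B N n) \<le> ennreal (Q * N powr \<theta>)" .
  qed (use Q in auto)
  define \<Gamma> where "\<Gamma> = (\<integral>\<^sup>+ x. ennreal (norm (g x) powr q) * indicator {0<..<1} x \<partial>lborel)"
  have lower: "of_nat N * \<Gamma> \<le> ennreal ((Q * N powr \<theta>) powr q)" if "N \<ge> 1" for N :: nat
  proof -
    define H where "H n x = (\<Sum>i<N. ennreal (norm (B N n (x + real n * 2 ^ i)) powr q)) * indicator {0<..<1} x" for n and x :: real
    have Hm[measurable]: "H n \<in> borel_measurable lborel" for n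
      unfolding H_def[abs_def] by measurable
    have "(\<lambda>n. H n x) \<longlonglongrightarrow> (\<Sum>i<N. ennreal (norm (g x) powr q)) * indicator {0<..<1} x" for x :: real
    proof (cases "x \<in> {0<..<1}")
      case True
      \<comment> \<open>The limit may be 0, where the power is still continuous because q >
        0.\<close>
      have "(\<lambda>n. \<Sum>i<N. ennreal (norm (B N n (x + real n * 2 ^ i)) powr q)) \<longlonglongrightarrow> (\<Sum>i<N. ennreal (norm (g x) powr q))"
        unfolding B_def g_def using q
        by (intro tendsto_sum tendsto_ennrealI tendsto_powr' tendsto_norm tendsto_const
            bilin_op_trains_tendsto[OF \<phi> \<psi>]) auto
      with True show ?thesis by (simp add: H_def)
    qed (simp add: H_def)
    then have "liminf (\<lambda>n. H n x) = of_nat N * (ennreal (norm (g x) powr q) * indicator {0<..<1} x)" for x :: real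
      by (subst lim_imp_Liminf) (auto simp: mult.assoc)
    then have "of_nat N * \<Gamma> = (\<integral>\<^sup>+ x. liminf (\<lambda>n. H n x) \<partial>lborel)"
      unfolding \<Gamma>_def by (simp add: nn_integral_cmult)
    also have "\<dots> \<le> liminf (\<lambda>n. \<integral>\<^sup>+ x. H n x \<partial>lborel)"
      by (rule nn_integral_liminf) measurable
    also have "\<dots> \<le> liminf (\<lambda>n. ennreal ((Q * N powr \<theta>) powr q))"
    proof (rule Liminf_mono, rule eventually_sequentiallyI[of N])
      fix n assume n: "n \<ge> N"
      \<comment> \<open>As n \<ge> N \<ge> 1, the shifts are distinct integers, hence at distance at
        least 1.\<close>
      have "1 \<le> \<bar>real n * 2 ^ i - real n * 2 ^ j\<bar>" if "i \<noteq> j" for i j :: nat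
      proof -
        have "(2::int) ^ i \<noteq> 2 ^ j" using that by simp
        then have "int n * 2 ^ i \<noteq> int n * 2 ^ j" using n \<open>N \<ge> 1\<close> by simp
        then have "1 \<le> \<bar>int n * 2 ^ i - int n * 2 ^ j\<bar>" by linarith
        then have "real_of_int 1 \<le> real_of_int \<bar>int n * 2 ^ i - int n * 2 ^ j\<bar>" by (simp only: of_int_le_iff)
        then show ?thesis by simp
      qed
      then have "(\<integral>\<^sup>+ x. H n x \<partial>lborel) \<le> (\<integral>\<^sup>+ y. ennreal (norm (B N n y) powr q) \<partial>lborel)"
        unfolding H_def
        by (intro sum_nn_integral_shifts_le[where h="\<lambda>y. ennreal (norm (B N n y) powr q)" and c="\<lambda>i. real n * 2 ^ i"]) auto
      also have "\<dots> \<le> ennreal ((Q * N powr \<theta>) powr q)" by (rule upper[OF that n])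
      finally show "(\<integral>\<^sup>+ x. H n x \<partial>lborel) \<le> ennreal ((Q * N powr \<theta>) powr q)" .
    qed
    also have "\<dots> = ennreal ((Q * N powr \<theta>) powr q)" by (simp add: Liminf_const)
    finally show ?thesis .
  qed
  \<comment> \<open>The case N = 1 makes \<Gamma> finite, so the estimate for general N can be read
    in the reals.\<close>
  have "\<Gamma> \<noteq> \<infinity>" using lower[of 1] by (auto simp: top_unique)
  then obtain \<gamma> where \<gamma>: "\<gamma> \<ge> 0" "\<Gamma> = ennreal \<gamma>" by (cases \<Gamma>) auto
  have bd: "\<gamma> \<le> Q powr q * real N powr (q * \<theta> - 1)" if "N \<ge> 1" for N :: nat
  proof -
    have "of_nat N * \<Gamma> = ennreal (real N * \<gamma>)" using \<gamma> by (simp add: ennreal_mult ennreal_of_nat_eq_real_of_nat)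
    with lower[OF that] have "real N * \<gamma> \<le> (Q * N powr \<theta>) powr q" by (simp add: ennreal_le_iff)
    also have "\<dots> = Q powr q * real N powr (q * \<theta>)"
      using Q by (simp add: powr_mult powr_powr mult.commute)
    finally show ?thesis
      using that by (simp add: powr_diff field_simps)
  qed
  have "q * \<theta> - 1 < 0" using less q by (simp add: \<theta>_def field_simps)
  then have lim0: "(\<lambda>N. Q powr q * real N powr (q * \<theta> - 1)) \<longlonglongrightarrow> 0"
    by (intro tendsto_mult_right_zero tendsto_neg_powr filterlim_real_sequentially)
  have "\<gamma> \<le> 0"
    by (rule tendsto_lowerbound[OF lim0 eventually_sequentiallyI[of 1]]) (use bd in simp_all)
  with \<gamma> have "\<Gamma> = 0" by simp
  then have "AE y in lborel. ennreal (norm (g y) powr q) * indicator {0<..<1} y = 0"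
    unfolding \<Gamma>_def by (subst (asm) nn_integral_0_iff_AE) auto
  then have AE: "AE y in lborel. y \<notin> {0<..<1} \<inter> {y. g y \<noteq> 0}"
    by eventually_elim (auto simp: indicator_def)
  have op: "open ({0<..<1} \<inter> {y. g y \<noteq> 0})"
    by (intro open_Int open_Collect_neq g_cont continuous_intros)
  \<comment> \<open>A nonempty open set is not Lebesgue null.\<close>
  have "{0<..<1} \<inter> {y. g y \<noteq> 0} = {}"
  proof -
    have "{0<..<1} \<inter> {y. g y \<noteq> 0} \<in> sets lborel"
      unfolding sets_lborel by (rule borel_open[OF op])
    then have "{0<..<1} \<inter> {y. g y \<noteq> 0} \<in> null_sets lborel"
      by (rule AE_iff_null_sets[THEN iffD2, OF _ AE])
    then have "negligible ({0<..<1} \<inter> {y. g y \<noteq> 0})"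
      unfolding negligible_iff_null_sets by (rule null_sets_completionI)
    then show ?thesis using open_not_negligible[OF op] by metis
  qed
  with x show ?thesis by (auto simp: g_def)
qed

text \<open>Bumps turn the hypothesis into vanishing integrals of \<open>Z\<close>, the symbol times
  a factor of modulus 1, over all rectangles. So M(\<xi> - \<eta>) = 0 for almost all (\<xi>,
  \<eta>), and the shear reads this off in t.\<close>

lemma AE_zero_of_bilin_op_zero:
  assumes zero: "\<And>A \<phi> \<psi>. test A \<phi> \<Longrightarrow> test A \<psi> \<Longrightarrow> bilin_op M (inv_fourier \<phi>) (inv_fourier \<psi>) x = 0"
  shows "AE t in lborel. M t = 0"
proof -
  define Z where "Z z = M (fst z - snd z) * cis (2 * pi * (fst z + snd z) * x)" for z
  have [measurable]: "Z \<in> borel_measurable (lborel \<Otimes>\<^sub>M lborel)"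
    unfolding Z_def[abs_def] cis_conv_exp by measurable
  have rect: "integrable (lborel \<Otimes>\<^sub>M lborel) (\<lambda>z. indicator ({a<..<b} \<times> {c<..<d}) z *\<^sub>R Z z)
     \<and> (LINT z|(lborel \<Otimes>\<^sub>M lborel). indicator ({a<..<b} \<times> {c<..<d}) z *\<^sub>R Z z) = 0" for a b c d
  proof -
    define A where "A = max (max \<bar>a\<bar> \<bar>b\<bar>) (max \<bar>c\<bar> \<bar>d\<bar>)"
    have A: "\<bar>a\<bar> \<le> A" "\<bar>b\<bar> \<le> A" "\<bar>c\<bar> \<le> A" "\<bar>d\<bar> \<le> A" by (auto simp: A_def le_max_iff_disj)
    have bump0: "bump s t n y = 0" if "\<bar>s\<bar> \<le> A" "\<bar>t\<bar> \<le> A" "A \<le> \<bar>y\<bar>" for s t y n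
    proof -
      have "y \<notin> {s<..<t}" using that by auto
      then show ?thesis using norm_bump_le[of s t n y] by simp
    qed
    then have t: "test A (bump a b n)" "test A (bump c d n)" for n
      using A by (auto simp: test_def smooth_bump)
    note [measurable] = test_measurable[OF t(1)] test_measurable[OF t(2)]
    let ?s = "\<lambda>n z. bump a b n (snd z + fst z) * bump c d n (snd z) * M (fst z) * cis (2 * pi * (snd z + fst z + snd z) * x)"
    let ?l = "\<lambda>z. indicator ({a<..<b} \<times> {c<..<d}) (snd z + fst z, snd z) *\<^sub>R Z (snd z + fst z, snd z)"
    \<comment> \<open>A majorant independent of n: the bumps are bounded by 1 and vanish outside
      [-A, A], which confines t to [-2A, 2A].\<close>
    let ?w = "\<lambda>z. norm ((indicator {-2*A..2*A} (fst z) *\<^sub>R M (fst z)) * complex_of_real (indicator {-A..A} (snd z)))"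
    have "integrable lborel (indicator {-A..A} :: real \<Rightarrow> real)"
      by (rule integrable_real_indicator) (auto simp: emeasure_lborel_Icc_eq)
    then have "integrable lborel (\<lambda>x. complex_of_real (indicator {-A..A} x))"
      by (rule integrable_of_real)
    then have w: "integrable (lborel \<Otimes>\<^sub>M lborel) ?w"
      using integrable_window[of "2*A"] by (intro integrable_norm integrable_pair_mult) auto
    have lim: "(\<lambda>n. ?s n z) \<longlonglongrightarrow> ?l z" for z
    proof -
      have "(\<lambda>n. ?s n z) \<longlonglongrightarrow> of_bool (snd z + fst z \<in> {a<..<b}) * of_bool (snd z \<in> {c<..<d}) * M (fst z) * cis (2 * pi * (snd z + fst z + snd z) * x)"
        by (intro tendsto_intros bump_tendsto)
      then show ?thesis by (auto simp: Z_def indicator_def of_bool_def)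
    qed
    have dom: "norm (?s n z) \<le> ?w z" for n z
    proof (cases "A \<le> \<bar>snd z\<bar> \<or> A \<le> \<bar>snd z + fst z\<bar>")
      case True
      then have "?s n z = 0" using bump0 A by auto
      then show ?thesis by (simp only: norm_zero norm_ge_zero)
    next
      case False
      then have "fst z \<in> {-2*A..2*A}" "snd z \<in> {-A..A}" by auto
      moreover have "norm (bump s t n y) \<le> 1" for s t y
        by (rule order.trans[OF norm_bump_le]) (simp add: indicator_def)
      then have "norm (bump a b n (snd z + fst z)) * norm (bump c d n (snd z)) * norm (M (fst z)) \<le> 1 * 1 * norm (M (fst z))"
        by (intro mult_mono mult_right_mono) auto
      ultimately show ?thesis by (simp add: norm_mult)
    qed
    have sm: "?s n \<in> borel_measurable (lborel \<Otimes>\<^sub>M lborel)" "?l \<in> borel_measurable (lborel \<Otimes>\<^sub>M lborel)" for n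
      unfolding cis_conv_exp by measurable
    have int: "integrable (lborel \<Otimes>\<^sub>M lborel) ?l"
      by (rule integrable_dominated_convergence[where s="?s" and f="?l" and w="?w", OF sm(2) sm(1) w AE_I2[OF lim] AE_I2[OF dom]])
    have "(\<lambda>n. LINT z|(lborel \<Otimes>\<^sub>M lborel). ?s n z) \<longlonglongrightarrow> (LINT z|(lborel \<Otimes>\<^sub>M lborel). ?l z)"
      by (rule integral_dominated_convergence[where s="?s" and f="?l" and w="?w", OF sm(2) sm(1) w AE_I2[OF lim] AE_I2[OF dom]])
    moreover have "(LINT z|(lborel \<Otimes>\<^sub>M lborel). ?s n z) = 0" for n
      using zero[OF t, of n n] unfolding bilin_op_sheared[OF t] .
    ultimately have "(LINT z|(lborel \<Otimes>\<^sub>M lborel). ?l z) = 0"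
      by (simp add: LIMSEQ_const_iff)
    then have "(LINT z|(lborel \<Otimes>\<^sub>M lborel). indicator ({a<..<b} \<times> {c<..<d}) z *\<^sub>R Z z) = 0"
      by (subst integral_shear) auto
    moreover have "integrable (distr (lborel \<Otimes>\<^sub>M lborel) (lborel \<Otimes>\<^sub>M lborel) (\<lambda>z. (snd z + fst z :: real, snd z)))
        (\<lambda>z. indicator ({a<..<b} \<times> {c<..<d}) z *\<^sub>R Z z)"
      using int by (subst integrable_distr_eq) auto
    ultimately show ?thesis by (simp only: distr_shear simp_thms)
  qed
  have "AE z in (lborel :: (real \<times> real) measure). Z z = 0"
    by (rule AE_zero_if_integral_box_zero)
       (use rect in \<open>auto simp: box_prod box_real lborel_prod\<close>)
  then have "AE z in distr (lborel \<Otimes>\<^sub>M lborel) (lborel \<Otimes>\<^sub>M lborel) (\<lambda>z. (snd z + fst z :: real, snd z)). Z z = 0"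
    unfolding distr_shear by (simp only: lborel_prod)
  then have "AE z in (lborel \<Otimes>\<^sub>M lborel). Z (snd z + fst z, snd z) = 0"
    by (rule AE_distr_iff[THEN iffD1, rotated 2]) measurable
  then have "AE z in (lborel \<Otimes>\<^sub>M (lborel :: real measure)). M (fst z) = 0"
    by (simp add: Z_def)
  \<comment> \<open>The property does not involve the second coordinate and \<open>lborel\<close> is
    not the null measure, so the inner quantifier disappears.\<close>
  from lborel_pair.AE_pair[OF this] show ?thesis
    by (simp add: eventually_const ae_filter_eq_bot_iff)
qed

end

theorem mainTheorem10:
  fixes p1 p2 p3 :: ennreal
  assumes "1 \<le> p1" and "1 \<le> p2" and "1 \<le> p3"
    and "1 / p1 + 1 / p2 < 1 / p3"
  shows "\<forall>M \<in> multiplier_space p1 p2 p3. AE x in lborel. M x = 0"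
proof
  fix M assume "M \<in> multiplier_space p1 p2 p3"
  then obtain C where meas: "M \<in> borel_measurable lborel"
    and loc: "\<And>K. compact K \<Longrightarrow> set_integrable lborel K M"
    and C: "\<And>f g. f \<in> P_class \<Longrightarrow> g \<in> P_class \<Longrightarrow>
       Lp_norm p3 (bilin_op M f g) \<le> ennreal C * Lp_norm p1 f * Lp_norm p2 g"
    unfolding multiplier_space_def by blast
  interpret loc_integrable M by unfold_locales (use meas loc in auto)
  \<comment> \<open>For an infinite exponent the right-hand side 1/p3 is 0, and nothing in
    \<open>ennreal\<close> lies below 0.\<close>
  have "p3 \<noteq> \<infinity>" using assms(4) by auto
  then obtain q where q: "p3 = ennreal q" "q \<ge> 0" by (cases p3) auto
  have q1: "q \<ge> 1" using assms(3) q by simp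
  have inv: "1 / p \<noteq> \<infinity>" if "1 \<le> p" for p :: ennreal
    using that by (auto simp: ennreal_divide_eq_top_iff)
  \<comment> \<open>All reciprocals are finite because the exponents are at least 1, so the
    inequality passes to the reals, with 1/\<infinity> read as 0.\<close>
  have "enn2real (1 / p1) + enn2real (1 / p2) = enn2real (1 / p1 + 1 / p2)"
    using inv assms(1,2) by (intro enn2real_plus[symmetric]) (auto simp: less_top)
  also have "\<dots> < enn2real (1 / p3)"
    using assms(4) inv[OF assms(3)]
    by (cases "1 / p1 + 1 / p2"; cases "1 / p3") (auto simp: ennreal_less_iff)
  also have "\<dots> = 1 / q" using divide_ennreal[of 1 q] q q1 by simp
  finally have less: "enn2real (1 / p1) + enn2real (1 / p2) < 1 / q" .
  show "AE x in lborel. M x = 0"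
  proof (rule AE_zero_of_bilin_op_zero)
    fix A \<phi> \<psi> assume "test A \<phi>" "test A \<psi>"
    \<comment> \<open>Any point of (0,1) would do in place of 1/2.\<close>
    then show "bilin_op M (inv_fourier \<phi>) (inv_fourier \<psi>) (1/2) = 0"
      using assms q1 less C unfolding q(1)
      by (intro bilin_op_zero_of_bound[where C=C and ?p1.0=p1 and ?p2.0=p2]) auto
  qed
qed

end
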